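(* Let $W(F)=\frac12|F|^2+h(\det F)$ for $F\in\mathbb{R}^{2\times2}$ with $h$ as in the context, and let $$I(g)=\int_{\mathbb{S}^1}W(\nabla u^g)\,d\theta,\qquad g\in W^{1,2}(\mathbb{S}^1,\mathbb{R}^2).$$ Let $\mathcal{C}$ be a subset of $W^{1,2}(\mathbb{S}^1,\mathbb{R}^2)$ such that $\mathcal{C}$ is non-empty and closed with respect to weak convergence in $W^{1,2}(\mathbb{S}^1,\mathbb{R}^2)$, and $I(g)<\infty$ for all $g\in\mathcal{C}$. Then $\mathcal{C}$ contains a global minimizer of $I$ (that is, there is $g\in\mathcal{C}$ with $I(g)\le I(\tilde g)$ for all $\tilde g\in\mathcal{C}$).
   Context: $h:\mathbb{R}\to(0,+\infty]$ satisfies: $h(t)=+\infty$ if $t\le 0$; $h(t)\to\infty$ as $t\to0+$; $h$ is positive, $C^2$ and strongly convex on $(0,\infty)$ (there is $\mu>0$ with $h''\ge\mu$). Functions on $\mathbb{S}^1$ are written as $2\pi$-periodic functions of the polar angle $\theta$, and $'$ denotes $d/d\theta$. For $g:\mathbb{S}^1\to\mathbb{R}^2$, $u^g(x)=|x|\,g(x/|x|)$ is the associated one-homogeneous map; with $e_R=(\cos\theta,\sin\theta)$, $e_\theta=(-\sin\theta,\cos\theta)$, one has $\nabla u^g=g\otimes e_R+g'\otimes e_\theta$, a function of $\theta$ only. *)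

theory Defs
  imports "HOL-Complex_Analysis.Complex_Analysis"
begin

text \<open>Functions on the circle are \<open>2\<pi>\<close>-periodic functions of the polar angle. Elements of
  \<open>L\<^sup>2\<close> and \<open>W\<^sup>1\<^sup>,\<^sup>2\<close> are given by Borel representatives; two representatives of the same
  class are not identified, but every notion below depends only on the class.\<close>

definition circle_L2 :: "(real \<Rightarrow> real^2) set" where
  "circle_L2 = {g. g \<in> borel_measurable borel \<and> (\<forall>\<theta>. g (\<theta> + 2 * pi) = g \<theta>) \<and>
     set_integrable lborel {0..2*pi} (\<lambda>\<theta>. (norm (g \<theta>))\<^sup>2)}"

definition circle_test :: "(real \<Rightarrow> real) \<Rightarrow> bool" where
  "circle_test \<phi> \<longleftrightarrow> (\<forall>\<theta>. \<phi> (\<theta> + 2 * pi) = \<phi> \<theta>) \<and>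
     (\<forall>n \<theta>. ((deriv ^^ n) \<phi>) differentiable (at \<theta>))"

text \<open>Test functions live on the whole circle, so a jump of \<open>g\<close> at \<open>\<theta> = 0\<close> is excluded.\<close>

definition has_circle_weak_deriv :: "(real \<Rightarrow> real^2) \<Rightarrow> (real \<Rightarrow> real^2) \<Rightarrow> bool" where
  "has_circle_weak_deriv g d \<longleftrightarrow> (\<forall>\<phi>. circle_test \<phi> \<longrightarrow>
     (LINT \<theta>:{0..2*pi}|lborel. deriv \<phi> \<theta> *\<^sub>R g \<theta>) = - (LINT \<theta>:{0..2*pi}|lborel. \<phi> \<theta> *\<^sub>R d \<theta>))"

definition circle_W12 :: "(real \<Rightarrow> real^2) set" where
  "circle_W12 = {g \<in> circle_L2. \<exists>d\<in>circle_L2. has_circle_weak_deriv g d}"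

definition weak_deriv :: "(real \<Rightarrow> real^2) \<Rightarrow> real \<Rightarrow> real^2" where
  "weak_deriv g = (SOME d. d \<in> circle_L2 \<and> has_circle_weak_deriv g d)"

definition W12_norm :: "(real \<Rightarrow> real^2) \<Rightarrow> real" where
  "W12_norm g = sqrt (LINT \<theta>:{0..2*pi}|lborel. (norm (g \<theta>))\<^sup>2 + (norm (weak_deriv g \<theta>))\<^sup>2)"

text \<open>Elements of the dual space; the values of \<open>l\<close> outside \<^const>\<open>circle_W12\<close> are irrelevant.
  The bound forces \<open>l\<close> to agree on representatives of the same class.\<close>

definition W12_dual :: "((real \<Rightarrow> real^2) \<Rightarrow> real) set" where
  "W12_dual = {l. (\<forall>f\<in>circle_W12. \<forall>g\<in>circle_W12. l (\<lambda>\<theta>. f \<theta> + g \<theta>) = l f + l g) \<and>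
     (\<forall>c. \<forall>g\<in>circle_W12. l (\<lambda>\<theta>. c *\<^sub>R g \<theta>) = c * l g) \<and>
     (\<exists>K. \<forall>g\<in>circle_W12. \<bar>l g\<bar> \<le> K * W12_norm g)}"

definition W12_weakly_converges :: "(nat \<Rightarrow> real \<Rightarrow> real^2) \<Rightarrow> (real \<Rightarrow> real^2) \<Rightarrow> bool" where
  "W12_weakly_converges X g \<longleftrightarrow> (\<forall>l\<in>W12_dual. (\<lambda>n. l (X n)) \<longlonglongrightarrow> l g)"

text \<open>Constant sequences show that a weakly closed set contains, with each function, every
  representative of its class.\<close>

definition W12_weakly_closed :: "(real \<Rightarrow> real^2) set \<Rightarrow> bool" where
  "W12_weakly_closed C \<longleftrightarrow>
     (\<forall>X g. (\<forall>n. X n \<in> C) \<longrightarrow> g \<in> circle_W12 \<longrightarrow> W12_weakly_converges X g \<longrightarrow> g \<in> C)"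

definition e_R :: "real \<Rightarrow> real^2" where
  "e_R \<theta> = vector [cos \<theta>, sin \<theta>]"

definition e_theta :: "real \<Rightarrow> real^2" where
  "e_theta \<theta> = vector [- sin \<theta>, cos \<theta>]"

definition tensor :: "real^2 \<Rightarrow> real^2 \<Rightarrow> real^2^2" where
  "tensor a b = (\<chi> i j. a $ i * b $ j)"

definition one_hom :: "(real \<Rightarrow> real^2) \<Rightarrow> real^2 \<Rightarrow> real^2" where
  "one_hom g x = norm x *\<^sub>R g (Arg (Complex (x $ 1) (x $ 2)))"

definition grad_one_hom :: "(real \<Rightarrow> real^2) \<Rightarrow> real \<Rightarrow> real^2^2" where
  "grad_one_hom g \<theta> = tensor (g \<theta>) (e_R \<theta>) + tensor (weak_deriv g \<theta>) (e_theta \<theta>)"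

text \<open>The formula for \<^const>\<open>grad_one_hom\<close> is the gradient of \<^const>\<open>one_hom\<close> wherever \<open>g\<close>
  is differentiable.\<close>

lemma one_hom_has_derivative:
  assumes per: "\<And>\<theta>. g (\<theta> + 2 * pi) = g \<theta>"
    and g: "(g has_vector_derivative d) (at \<theta>)" and r: "0 < r"
  shows "(one_hom g has_derivative
      (*v) (tensor (g \<theta>) (e_R \<theta>) + tensor d (e_theta \<theta>))) (at (r *\<^sub>R e_R \<theta>))"
proof -
  define z where "z = (\<lambda>x::real^2. complex_of_real (x $ 1) + \<i> * complex_of_real (x $ 2))"
  define \<alpha> where "\<alpha> = (\<lambda>x. \<theta> + Im (Ln (z x * cis (-\<theta>))))"
  define x0 where "x0 = r *\<^sub>R e_R \<theta>"
  have z0: "z x0 = of_real r * cis \<theta>"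
    by (simp add: z_def x0_def e_R_def complex_eq_iff)
  have z0': "z x0 * cis (-\<theta>) = of_real r"
    by (simp add: z0 cis_mult mult.assoc)
  have nx0: "norm x0 = r"
    using r by (simp add: x0_def e_R_def norm_vec_def L2_set_def sum_2 power_mult_distrib
        flip: distrib_left)
  have zC: "z x = Complex (x $ 1) (x $ 2)" for x
    by (simp add: z_def complex_eq_iff)
  have perN: "g (t + 2 * pi * real n) = g t" for t n
  proof (induction n)
    case (Suc n)
    then show ?case using per[of "t + 2 * pi * real n"] by (simp add: algebra_simps)
  qed simp
  have perI: "g (t + 2 * pi * of_int k) = g t" for t k
  proof (cases k)
    case (nonneg n)
    then show ?thesis using perN[of t n] by simp
  next
    case (neg n)
    then have "of_int k = - real (Suc n)"
      by simp
    then have "t + 2 * pi * of_int k + 2 * pi * real (Suc n) = t"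
      by (simp only: mult_minus_right diff_add_cancel add_uminus_conv_diff)
    then show ?thesis using perN[of "t + 2 * pi * of_int k" "Suc n"] by (simp only:)
  qed
  have eq: "one_hom g x = norm x *\<^sub>R g (\<alpha> x)" for x
  proof (cases "x = 0")
    case False
    then have zx: "z x \<noteq> 0"
      by (auto simp: z_def complex_eq_iff vec_eq_iff forall_2)
    have "cis (\<alpha> x) = cis \<theta> * cis (Arg (z x * cis (-\<theta>)))"
      using zx by (simp add: \<alpha>_def Arg_def cis_mult)
    also have "\<dots> = cis \<theta> * sgn (z x * cis (-\<theta>))"
      using zx by (subst cis_Arg) auto
    also have "\<dots> = sgn (z x)"
      by (simp add: sgn_mult sgn_cis mult.left_commute cis_mult)
    also have "\<dots> = cis (Arg (z x))"
      using zx by (simp add: cis_Arg)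
    finally have "exp (\<i> * of_real (\<alpha> x)) = exp (\<i> * of_real (Arg (z x)))"
      by (simp add: cis_conv_exp)
    then obtain k::int where "\<i> * of_real (\<alpha> x) = \<i> * of_real (Arg (z x)) + of_int (2 * k) * pi * \<i>"
      unfolding exp_eq by blast
    then have "\<alpha> x = Arg (z x) + 2 * pi * of_int k"
      by (simp add: complex_eq_iff)
    then show ?thesis
      by (simp add: one_hom_def perI flip: zC)
  qed (simp add: one_hom_def)
  have dz: "(z has_derivative z) (at x0)"
    unfolding z_def
    by (auto intro!: derivative_eq_intros
        bounded_linear.has_derivative[OF bounded_linear_vec_nth has_derivative_ident])
  have nonpos: "of_real r \<notin> (\<real>\<^sub>\<le>\<^sub>0 :: complex set)"
    using r by simp
  have "(Ln has_derivative (*) (inverse (of_real r))) (at (z x0 * cis (-\<theta>)))"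
    using has_field_derivative_Ln[OF nonpos] z0' by (simp add: has_field_derivative_def)
  from has_derivative_compose[OF has_derivative_mult_left[OF dz] this]
  have "((\<lambda>x. Ln (z x * cis (-\<theta>))) has_derivative
      (\<lambda>v. inverse (of_real r) * (z v * cis (-\<theta>)))) (at x0)" .
  from has_derivative_add[OF has_derivative_const[of \<theta>] has_derivative_Im[OF this]]
  have "(\<alpha> has_derivative (\<lambda>v. Im (inverse (of_real r) * (z v * cis (-\<theta>))))) (at x0)"
    unfolding \<alpha>_def by (simp only: add_0)
  moreover have "Im (inverse (of_real r) * (z v * cis (-\<theta>))) = (e_theta \<theta> \<bullet> v) / r" for v
    using r by (simp add: z_def e_theta_def inner_vec_def sum_2 divide_simps algebra_simps
        flip: of_real_inverse)
  ultimately have d\<alpha>: "(\<alpha> has_derivative (\<lambda>v. (e_theta \<theta> \<bullet> v) / r)) (at x0)"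
    by simp
  have \<alpha>0: "\<alpha> x0 = \<theta>"
    using r z0' by (simp add: \<alpha>_def)
  have "((\<lambda>x. g (\<alpha> x)) has_derivative (\<lambda>v. ((e_theta \<theta> \<bullet> v) / r) *\<^sub>R d)) (at x0)"
    using has_derivative_compose[OF d\<alpha>, of g] g \<alpha>0 by (simp add: has_vector_derivative_def)
  moreover have "(norm has_derivative (\<lambda>v. e_R \<theta> \<bullet> v)) (at x0)"
  proof -
    have "x0 \<noteq> 0" using nx0 r by auto
    moreover have "sgn x0 = e_R \<theta>"
      using r nx0 by (simp add: sgn_div_norm x0_def)
    ultimately show ?thesis
      using has_derivative_norm[of x0] by (simp add: inner_commute)
  qed
  ultimately have "((\<lambda>x. norm x *\<^sub>R g (\<alpha> x)) has_derivative
      (\<lambda>v. norm x0 *\<^sub>R (((e_theta \<theta> \<bullet> v) / r) *\<^sub>R d) + (e_R \<theta> \<bullet> v) *\<^sub>R g (\<alpha> x0))) (at x0)"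
    by (rule has_derivative_scaleR[rotated])
  moreover have "norm x0 *\<^sub>R (((e_theta \<theta> \<bullet> v) / r) *\<^sub>R d) + (e_R \<theta> \<bullet> v) *\<^sub>R g (\<alpha> x0) =
      (tensor (g \<theta>) (e_R \<theta>) + tensor d (e_theta \<theta>)) *v v" for v
    using r by (simp add: nx0 \<alpha>0 vec_eq_iff tensor_def matrix_vector_mult_def inner_vec_def sum_2
        field_simps)
  ultimately show ?thesis
    by (simp add: eq[abs_def] x0_def)
qed

text \<open>Values in \<open>(0, +\<infinity>]\<close> are modelled by \<^typ>\<open>ennreal\<close>.\<close>

definition det_energy :: "(real \<Rightarrow> ennreal) \<Rightarrow> bool" where
  "det_energy h \<longleftrightarrow> (\<forall>t\<le>0. h t = \<infinity>) \<and> (h \<longlongrightarrow> \<infinity>) (at_right 0) \<and> (\<forall>t>0. 0 < h t \<and> h t < \<infinity>) \<and>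
     (\<exists>h' h''. \<exists>\<mu>>0.
        (\<forall>t>0. ((\<lambda>s. enn2real (h s)) has_real_derivative h' t) (at t)) \<and>
        (\<forall>t>0. (h' has_real_derivative h'' t) (at t)) \<and>
        continuous_on {0<..} h'' \<and> (\<forall>t>0. \<mu> \<le> h'' t))"

definition stored_energy :: "(real \<Rightarrow> ennreal) \<Rightarrow> real^2^2 \<Rightarrow> ennreal" where
  "stored_energy h F = ennreal ((norm F)\<^sup>2 / 2) + h (det F)"

definition circle_energy :: "(real \<Rightarrow> ennreal) \<Rightarrow> (real \<Rightarrow> real^2) \<Rightarrow> ennreal" where
  "circle_energy h g = (\<integral>\<^sup>+\<theta>\<in>{0..2*pi}. stored_energy h (grad_one_hom g \<theta>) \<partial>lborel)"

end

theory Submission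
  imports Defs
begin

text \<open>A minimizing sequence is bounded in \<open>W\<^sup>1\<^sup>,\<^sup>2\<close>, hence uniformly Hoelder continuous, and by Arzela-Ascoli
  a subsequence \<open>X\<close> converges uniformly to some \<open>G\<close>. Weak compactness, Riesz representation and Mazur's
  lemma are all replaced by one device: in the set of iterated midpoints of the tails of a bounded
  sequence in \<open>L\<^sup>2\<close>, nearly norm-minimal elements converge strongly, by the parallelogram law.
  Applied to \<open>(X, X')\<close> along any further subsequence, this yields a limit which must be \<open>G\<close>; so every
  bounded functional has \<open>l(G)\<close> as its only limit point along \<open>X\<close>, which is weak convergence.
  Applied to \<open>(X, X', det)\<close>, where \<open>det\<close> is \<open>X \<and> X'\<close>, the third component of the limit is
  \<open>G \<and> G'\<close> since \<open>X\<close> converges uniformly. The energy density is jointly convex in these three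
  components and continuous into \<open>[0, \<infinity>]\<close>, so midpoints do not increase the energy and Fatou's lemma
  gives lower semicontinuity.\<close>

section \<open>Square-integrable functions and midpoint hulls\<close>

text \<open>The energy is not convex in the map itself: \<open>e_R\<close> and its negative both
  have determinant 1, while their midpoint is the zero map, with infinite energy. Convexity appears
  only once the determinant is an independent variable. The price is that a midpoint of the triples
  belonging to two maps is in general not the triple of a map, so the relation between the third
  component and the first two is lost in the hull and has to be recovered in the limit. It is
  recovered because, with \<open>G x\<close> in place of the moving first factor, the wedge product
  is linear in the second factor, and the error of that replacement is a small multiple of the norm
  of the derivative. Everything else that the limit must inherit is convex too: closeness to
  \<open>G\<close>, a lower bound on a linear functional, an upper bound on the energy. Convergence
  almost everywhere, which comes with strong convergence along a subsequence, makes a density with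
  the value infinity manageable, since Fatou's lemma then asks only for its pointwise
  continuity.\<close>

definition square_integrable :: "'a measure \<Rightarrow> ('a \<Rightarrow> 'b::euclidean_space) set" where
  "square_integrable M = {f \<in> borel_measurable M. integrable M (\<lambda>x. (norm (f x))\<^sup>2)}"

definition sq_norm :: "'a measure \<Rightarrow> ('a \<Rightarrow> 'b::euclidean_space) \<Rightarrow> real" where
  "sq_norm M f = (\<integral>x. (norm (f x))\<^sup>2 \<partial>M)"

lemma square_integrable_measurable [measurable_dest]:
  "f \<in> square_integrable M \<Longrightarrow> f \<in> borel_measurable M"
  by (simp add: square_integrable_def)

lemma square_integrable_integrable:
  "f \<in> square_integrable M \<Longrightarrow> integrable M (\<lambda>x. (norm (f x))\<^sup>2)"
  by (simp add: square_integrable_def)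

lemma sq_norm_nonneg: "0 \<le> sq_norm M f"
  by (simp add: sq_norm_def)

lemma norm_add_sq_le: "(norm (a + b))\<^sup>2 \<le> 2 * (norm a)\<^sup>2 + 2 * (norm (b::'b::real_normed_vector))\<^sup>2"
proof -
  have "(norm (a + b))\<^sup>2 \<le> (norm a + norm b)\<^sup>2"
    by (simp add: norm_triangle_ineq power_mono)
  also have "\<dots> \<le> 2 * (norm a)\<^sup>2 + 2 * (norm b)\<^sup>2"
    using sum_squares_bound[of "norm a" "norm b"] by (simp add: power2_sum)
  finally show ?thesis .
qed

lemma square_integrable_bound:
  assumes "f \<in> borel_measurable M" "integrable M g" "\<And>x. (norm (f x))\<^sup>2 \<le> g x"
  shows "f \<in> square_integrable M"
  unfolding square_integrable_def using assms
  by (auto intro!: Bochner_Integration.integrable_bound[OF assms(2)] AE_I2 simp: order_trans[OF assms(3) abs_ge_self])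

lemma square_integrable_add:
  assumes "f \<in> square_integrable M" "g \<in> square_integrable M"
  shows "(\<lambda>x. f x + g x) \<in> square_integrable M"
proof (rule square_integrable_bound)
  show "integrable M (\<lambda>x. 2 * (norm (f x))\<^sup>2 + 2 * (norm (g x))\<^sup>2)"
    using assms by (simp add: square_integrable_integrable)
qed (use assms in \<open>auto intro: norm_add_sq_le square_integrable_measurable borel_measurable_add\<close>)

lemma square_integrable_scaleR:
  assumes "f \<in> square_integrable M"
  shows "(\<lambda>x. c *\<^sub>R f x) \<in> square_integrable M"
  using assms by (auto simp: square_integrable_def power_mult_distrib)

lemma square_integrable_diff:
  assumes "f \<in> square_integrable M" "g \<in> square_integrable M"
  shows "(\<lambda>x. f x - g x) \<in> square_integrable M"
  using square_integrable_add[OF assms(1) square_integrable_scaleR[OF assms(2), of "-1"]] by simp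

lemma sq_norm_scaleR: "sq_norm M (\<lambda>x. c *\<^sub>R f x) = c\<^sup>2 * sq_norm M f"
  by (simp add: sq_norm_def power_mult_distrib)

text \<open>Solved for the difference because the midpoint stays in a midpoint hull: a lower bound
  for its norm turns near-minimality of \<open>f\<close> and \<open>g\<close> into
  closeness.\<close>

lemma sq_norm_parallelogram:
  assumes "f \<in> square_integrable M" "g \<in> square_integrable M"
  shows "sq_norm M (\<lambda>x. f x - g x) =
    2 * sq_norm M f + 2 * sq_norm M g - 4 * sq_norm M (\<lambda>x. (1/2) *\<^sub>R (f x + g x))"
proof -
  have "sq_norm M (\<lambda>x. f x - g x) + sq_norm M (\<lambda>x. f x + g x) =
      (\<integral>x. (norm (f x - g x))\<^sup>2 + (norm (f x + g x))\<^sup>2 \<partial>M)"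
    unfolding sq_norm_def
    using assms square_integrable_diff[OF assms] square_integrable_add[OF assms]
    by (simp add: square_integrable_integrable)
  also have "\<dots> = (\<integral>x. 2 * (norm (f x))\<^sup>2 + 2 * (norm (g x))\<^sup>2 \<partial>M)"
    by (rule Bochner_Integration.integral_cong) (simp_all add: power2_norm_eq_inner algebra_simps inner_commute)
  also have "\<dots> = 2 * sq_norm M f + 2 * sq_norm M g"
    using assms by (simp add: sq_norm_def square_integrable_integrable)
  finally show ?thesis
    by (simp add: sq_norm_scaleR power_divide)
qed

lemma ennreal_sq_norm:
  assumes "f \<in> square_integrable M"
  shows "(\<integral>\<^sup>+x. ennreal ((norm (f x))\<^sup>2) \<partial>M) = ennreal (sq_norm M f)"
  unfolding sq_norm_def using assms
  by (intro nn_integral_eq_integral square_integrable_integrable) simp_all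

text \<open>Fatou's lemma bounds nonnegative integrals before any integrability is known; this turns
  such a bound into membership and a bound on \<open>sq_norm\<close>.\<close>

lemma square_integrable_nn_integral:
  assumes "f \<in> borel_measurable M" "(\<integral>\<^sup>+x. ennreal ((norm (f x))\<^sup>2) \<partial>M) \<le> ennreal c"
  shows "f \<in> square_integrable M" "0 \<le> c \<Longrightarrow> sq_norm M f \<le> c"
proof -
  show *: "f \<in> square_integrable M"
    unfolding square_integrable_def using assms
    by (auto intro!: integrableI_bounded simp: less_top[symmetric] top_unique)
  show "sq_norm M f \<le> c" if "0 \<le> c"
    using assms(2) that unfolding ennreal_sq_norm[OF *] by simp
qed

lemma sq_norm_cong_AE:
  assumes "f \<in> borel_measurable M" "g \<in> borel_measurable M" "AE x in M. f x = g x"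
  shows "sq_norm M f = sq_norm M g"
  unfolding sq_norm_def using assms by (intro integral_cong_AE) auto

lemma square_integrable_cong_AE:
  assumes "f \<in> square_integrable M" "g \<in> borel_measurable M" "AE x in M. f x = g x"
  shows "g \<in> square_integrable M"
proof -
  have "integrable M (\<lambda>x. (norm (f x))\<^sup>2) \<longleftrightarrow> integrable M (\<lambda>x. (norm (g x))\<^sup>2)"
    using assms square_integrable_measurable[OF assms(1)] by (intro integrable_cong_AE) auto
  then show ?thesis
    using assms by (simp add: square_integrable_def)
qed

section \<open>The Cauchy-Schwarz inequality and its consequences on finite measures\<close>

lemma Cauchy_Schwarz_integral:
  fixes f g :: "'a \<Rightarrow> real"
  assumes f: "f \<in> square_integrable M" and g: "g \<in> square_integrable M"
  shows "integrable M (\<lambda>x. f x * g x)" "(\<integral>x. f x * g x \<partial>M)\<^sup>2 \<le> sq_norm M f * sq_norm M g"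
proof -
  have int2: "integrable M (\<lambda>x. (f x)\<^sup>2)" "integrable M (\<lambda>x. (g x)\<^sup>2)"
    using f g by (auto dest: square_integrable_integrable)
  have [measurable]: "f \<in> borel_measurable M" "g \<in> borel_measurable M"
    using f g by (auto intro: square_integrable_measurable)
  show int: "integrable M (\<lambda>x. f x * g x)"
  proof (rule Bochner_Integration.integrable_bound)
    show "integrable M (\<lambda>x. (f x)\<^sup>2 + (g x)\<^sup>2)"
      using int2 by simp
    have "norm (f x * g x) \<le> norm ((f x)\<^sup>2 + (g x)\<^sup>2)" for x
    proof -
      have "2 * \<bar>f x * g x\<bar> \<le> (f x)\<^sup>2 + (g x)\<^sup>2"
        using sum_squares_bound[of "\<bar>f x\<bar>" "\<bar>g x\<bar>"] by (simp add: abs_mult)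
      then show ?thesis
        using abs_ge_zero[of "f x * g x"] by simp
    qed
    then show "AE x in M. norm (f x * g x) \<le> norm ((f x)\<^sup>2 + (g x)\<^sup>2)"
      by simp
  qed measurable
  define F G X where "F = sq_norm M f" and "G = sq_norm M g" and "X = (\<integral>x. f x * g x \<partial>M)"
  have quad: "0 \<le> F - 2 * t * X + t\<^sup>2 * G" for t
  proof -
    have "0 \<le> (\<integral>x. (f x - t * g x)\<^sup>2 \<partial>M)"
      by simp
    also have "\<dots> = (\<integral>x. (f x)\<^sup>2 - 2 * t * (f x * g x) + t\<^sup>2 * (g x)\<^sup>2 \<partial>M)"
      by (rule Bochner_Integration.integral_cong) (simp_all add: power2_eq_square algebra_simps)
    also have "\<dots> = F - 2 * t * X + t\<^sup>2 * G"
      using int int2 by (simp add: F_def G_def X_def sq_norm_def)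
    finally show ?thesis .
  qed
  have "0 \<le> G"
    by (simp add: G_def sq_norm_nonneg)
  have "X\<^sup>2 \<le> F * G"
  proof (cases "G = 0")
    case True
    \<comment> \<open>With \<open>G = 0\<close> the quadratic is affine in \<open>t\<close>; if
      \<open>X\<close> were nonzero, it would take the value -1 at
      \<open>t = (F + 1) / (2 * X)\<close>.\<close>
    have "X = 0"
    proof (rule ccontr)
      assume "X \<noteq> 0"
      then show False
        using quad[of "(F + 1) / (2 * X)"] True by simp
    qed
    then show ?thesis using True by simp
  next
    case False
    then have "0 \<le> G * (F - 2 * (X / G) * X + (X / G)\<^sup>2 * G)"
      using quad[of "X / G"] \<open>0 \<le> G\<close> by (intro mult_nonneg_nonneg)
    also have "\<dots> = F * G - X\<^sup>2"
      using False by (simp add: field_simps power2_eq_square)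
    finally show ?thesis by simp
  qed
  then show "(\<integral>x. f x * g x \<partial>M)\<^sup>2 \<le> sq_norm M f * sq_norm M g"
    by (simp add: F_def G_def X_def)
qed

lemma square_integrable_norm:
  "f \<in> square_integrable M \<Longrightarrow> (\<lambda>x. norm (f x)) \<in> square_integrable M"
  by (auto simp: square_integrable_def)

lemma sq_norm_norm [simp]: "sq_norm M (\<lambda>x. norm (f x)) = sq_norm M f"
  by (simp add: sq_norm_def)

lemma (in finite_measure) square_integrable_indicator:
  "A \<in> sets M \<Longrightarrow> (indicator A :: 'a \<Rightarrow> real) \<in> square_integrable M"
  by (rule square_integrable_bound[where g = "indicator A"])
    (auto simp: less_top[symmetric] split: split_indicator)

lemma (in finite_measure) sq_norm_indicator:
  "A \<in> sets M \<Longrightarrow> sq_norm M (indicator A :: 'a \<Rightarrow> real) = measure M A"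
  by (simp add: sq_norm_def power2_eq_square flip: indicator_inter_arith)

text \<open>Cauchy-Schwarz against an indicator. The factor \<open>measure M A\<close> under the
  root later becomes the Hoelder exponent 1/2 of primitives.\<close>

lemma (in finite_measure) set_integral_norm_le:
  assumes f: "f \<in> square_integrable M" and A: "A \<in> sets M"
  shows "integrable M (\<lambda>x. indicator A x * norm (f x))"
    "(\<integral>x. indicator A x * norm (f x) \<partial>M) \<le> sqrt (measure M A * sq_norm M f)"
  using Cauchy_Schwarz_integral[OF square_integrable_indicator[OF A] square_integrable_norm[OF f]]
  by (auto simp: sq_norm_indicator[OF A] intro: real_le_rsqrt)

lemma (in finite_measure) integral_norm_le:
  assumes f: "f \<in> square_integrable M"
  shows "integrable M f" "(\<integral>x. norm (f x) \<partial>M) \<le> sqrt (measure M (space M) * sq_norm M f)"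
proof -
  have *: "integrable M (\<lambda>x. norm (f x)) = integrable M (\<lambda>x. indicator (space M) x * norm (f x))"
    by (rule Bochner_Integration.integrable_cong) auto
  have "(\<integral>x. norm (f x) \<partial>M) = (\<integral>x. indicator (space M) x * norm (f x) \<partial>M)"
    by (rule Bochner_Integration.integral_cong) auto
  then show "(\<integral>x. norm (f x) \<partial>M) \<le> sqrt (measure M (space M) * sq_norm M f)"
    using set_integral_norm_le(2)[OF f sets.top] by simp
  show "integrable M f"
    using set_integral_norm_le(1)[OF f sets.top] f
    by (subst integrable_norm_iff[symmetric]) (auto simp: * intro: square_integrable_measurable)
qed

text \<open>The weights \<open>2 ^ k\<close> and AM-GM replace the Cauchy-Schwarz inequality, so no bound on the
  total mass is needed.\<close>

lemma AE_convergent_of_rapid: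
  fixes P :: "nat \<Rightarrow> 'a \<Rightarrow> 'b::euclidean_space"
  assumes P: "\<And>k. P k \<in> square_integrable M"
    and rapid: "\<And>k. sq_norm M (\<lambda>x. P (Suc k) x - P k x) \<le> (1/4) ^ k"
  shows "AE x in M. convergent (\<lambda>k. P k x)"
proof -
  define D where "D = (\<lambda>k x. 2 ^ k * (norm (P (Suc k) x - P k x))\<^sup>2)"
  have D: "integrable M (D k)" "(\<integral>x. D k x \<partial>M) \<le> (1/2) ^ k" for k
  proof -
    show "integrable M (D k)"
      unfolding D_def using square_integrable_diff[OF P P]
      by (simp add: square_integrable_integrable)
    have "(\<integral>x. D k x \<partial>M) = 2 ^ k * sq_norm M (\<lambda>x. P (Suc k) x - P k x)"
      by (simp add: D_def sq_norm_def)
    also have "\<dots> \<le> 2 ^ k * (1/4) ^ k"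
      by (intro mult_left_mono rapid) simp
    also have "\<dots> = (1/2) ^ k"
      by (simp flip: power_mult_distrib)
    finally show "(\<integral>x. D k x \<partial>M) \<le> (1/2) ^ k" .
  qed
  have [measurable]: "D k \<in> borel_measurable M" for k
    using D(1) by auto
  have D0: "0 \<le> D k x" for k x
    by (simp add: D_def)
  have "(\<integral>\<^sup>+x. (\<Sum>k. ennreal (D k x)) \<partial>M) = (\<Sum>k. \<integral>\<^sup>+x. ennreal (D k x) \<partial>M)"
    by (rule nn_integral_suminf) measurable
  also have "\<dots> = (\<Sum>k. ennreal (\<integral>x. D k x \<partial>M))"
    using D by (simp add: nn_integral_eq_integral D0)
  also have "\<dots> \<le> (\<Sum>k. ennreal ((1/2) ^ k))"
    by (intro suminf_le ennreal_leI D summableI)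
  also have "\<dots> = ennreal (\<Sum>k. (1/2) ^ k)"
    by (intro suminf_ennreal2) (simp_all add: summable_geometric)
  also have "\<dots> < \<infinity>"
    by simp
  finally have "AE x in M. (\<Sum>k. ennreal (D k x)) \<noteq> \<infinity>"
    by (intro nn_integral_PInf_AE) auto
  then show ?thesis
  proof eventually_elim
    case (elim x)
    then have sD: "summable (\<lambda>k. D k x)"
      using D0 by (intro summable_suminf_not_top) auto
    have "summable (\<lambda>k. (1/2) ^ k + D k x)"
      using sD by (intro summable_add) (simp_all add: summable_geometric)
    moreover have "norm (P (Suc k) x - P k x) \<le> (1/2) ^ k + D k x" for k
    proof -
      define a where "a = norm (P (Suc k) x - P k x)"
      have "0 \<le> (1/2)^k * (1 - 2^k * a)\<^sup>2"
        by simp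
      also have "\<dots> = (1/2)^k - 2 * a + 2^k * a\<^sup>2"
        by (simp add: power2_eq_square algebra_simps power_divide)
      finally have "2 * a \<le> (1/2)^k + D k x"
        by (simp add: D_def a_def)
      moreover have "0 \<le> a"
        by (simp add: a_def)
      ultimately have "a \<le> (1/2)^k + D k x"
        by linarith
      then show ?thesis
        by (simp only: a_def)
    qed
    ultimately have "summable (\<lambda>k. P (Suc k) x - P k x)"
      by (rule summable_comparison_test'[where N = 0])
    then have "convergent (\<lambda>n. \<Sum>k<n. P (Suc k) x - P k x)"
      by (simp add: summable_iff_convergent)
    moreover have "(\<Sum>k<n. P (Suc k) x - P k x) = P n x - P 0 x" for n
      by (rule sum_lessThan_telescope)
    ultimately have "convergent (\<lambda>n. P n x - P 0 x)"
      by simp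
    then have "convergent (\<lambda>n. (P n x - P 0 x) + P 0 x)"
      by (intro convergent_add convergent_const)
    then show ?case by simp
  qed
qed

text \<open>Along a subsequence with increments below \<open>(1/4) ^ k\<close> there is convergence
  almost everywhere. Fatou's lemma, applied to the distances from a fixed member to the later ones,
  bounds its distance to the limit. Both kinds of convergence are exported, since the energy is
  treated pointwise and the derivative in L2.\<close>

theorem Riesz_Fischer:
  fixes P :: "nat \<Rightarrow> 'a \<Rightarrow> 'b::euclidean_space"
  assumes P: "\<And>k. P k \<in> square_integrable M"
    and Cauchy: "\<And>e. 0 < e \<Longrightarrow> \<exists>N. \<forall>m\<ge>N. \<forall>n\<ge>N. sq_norm M (\<lambda>x. P m x - P n x) \<le> e"
  obtains s p where "strict_mono (s::nat \<Rightarrow> nat)" "p \<in> square_integrable M"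
    "AE x in M. (\<lambda>k. P (s k) x) \<longlonglongrightarrow> p x"
    "(\<lambda>k. sq_norm M (\<lambda>x. P (s k) x - p x)) \<longlonglongrightarrow> 0"
proof -
  obtain N where N: "\<And>k m n. m \<ge> N k \<Longrightarrow> n \<ge> N k \<Longrightarrow> sq_norm M (\<lambda>x. P m x - P n x) \<le> (1/4) ^ k"
  proof -
    have "\<exists>N. \<forall>m\<ge>N. \<forall>n\<ge>N. sq_norm M (\<lambda>x. P m x - P n x) \<le> (1/4) ^ k" for k
      by (rule Cauchy) simp
    then show ?thesis using that by metis
  qed
  \<comment> \<open>\<open>Suc r\<close> inside the maximum forces strict growth;
    \<open>N (Suc k)\<close> keeps the index beyond the next threshold.\<close>
  define s where "s = rec_nat (N 0) (\<lambda>k r. max (N (Suc k)) (Suc r))"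
  have s_Suc: "s (Suc k) = max (N (Suc k)) (Suc (s k))" and s_0: "s 0 = N 0" for k
    by (simp_all add: s_def)
  have s: "strict_mono s"
    by (intro strict_monoI_Suc) (simp add: s_Suc less_max_iff_disj)
  have sN: "N k \<le> s k" for k
    by (cases k) (simp_all add: s_0 s_Suc)
  have tail: "sq_norm M (\<lambda>x. P (s i) x - P (s j) x) \<le> (1/4) ^ k" if "k \<le> i" "k \<le> j" for i j k
    by (rule N) (use sN[of k] that s[THEN strict_mono_leD] order_trans in blast)+
  have "AE x in M. convergent (\<lambda>k. P (s k) x)"
    by (rule AE_convergent_of_rapid) (simp_all add: P tail)
  \<comment> \<open>Where the sequence diverges \<open>lim\<close> is an unspecified value; this
    happens only on a null set, and \<open>p\<close> is measurable all the same.\<close>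
  define p where "p = (\<lambda>x. lim (\<lambda>k. P (s k) x))"
  have [measurable]: "P k \<in> borel_measurable M" for k
    using P square_integrable_measurable by blast
  have pm [measurable]: "p \<in> borel_measurable M"
    unfolding p_def by measurable
  have lim: "AE x in M. (\<lambda>k. P (s k) x) \<longlonglongrightarrow> p x"
    using \<open>AE x in M. convergent (\<lambda>k. P (s k) x)\<close>
    by eventually_elim (simp add: p_def convergent_LIMSEQ_iff)
  have bound: "(\<integral>\<^sup>+x. ennreal ((norm (P (s k) x - p x))\<^sup>2) \<partial>M) \<le> ennreal ((1/4) ^ k)" for k
  proof -
    have "(\<integral>\<^sup>+x. ennreal ((norm (P (s k) x - p x))\<^sup>2) \<partial>M) =
        (\<integral>\<^sup>+x. liminf (\<lambda>j. ennreal ((norm (P (s k) x - P (s j) x))\<^sup>2)) \<partial>M)"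
    proof (rule nn_integral_cong_AE)
      show "AE x in M. ennreal ((norm (P (s k) x - p x))\<^sup>2) =
          liminf (\<lambda>j. ennreal ((norm (P (s k) x - P (s j) x))\<^sup>2))"
        using lim
      proof eventually_elim
        case (elim x)
        then have "(\<lambda>j. ennreal ((norm (P (s k) x - P (s j) x))\<^sup>2)) \<longlonglongrightarrow>
            ennreal ((norm (P (s k) x - p x))\<^sup>2)"
          by (intro tendsto_intros)
        then show ?case
          by (intro lim_imp_Liminf[symmetric]) simp_all
      qed
    qed
    also have "\<dots> \<le> liminf (\<lambda>j. \<integral>\<^sup>+x. ennreal ((norm (P (s k) x - P (s j) x))\<^sup>2) \<partial>M)"
      by (rule nn_integral_liminf) measurable
    also have "\<dots> \<le> ennreal ((1/4) ^ k)"
    proof (rule Liminf_le)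
      show "\<forall>\<^sub>F j in sequentially. (\<integral>\<^sup>+x. ennreal ((norm (P (s k) x - P (s j) x))\<^sup>2) \<partial>M) \<le> ennreal ((1/4) ^ k)"
        using eventually_ge_at_top[of k]
        by eventually_elim
          (subst ennreal_sq_norm, auto intro!: square_integrable_diff P tail ennreal_leI)
    qed simp
    finally show ?thesis .
  qed
  have d: "(\<lambda>x. P (s k) x - p x) \<in> square_integrable M" "sq_norm M (\<lambda>x. P (s k) x - p x) \<le> (1/4) ^ k" for k
    by (rule square_integrable_nn_integral[OF _ bound]; simp)+
  have "(\<lambda>x. P (s 0) x - (P (s 0) x - p x)) \<in> square_integrable M"
    by (intro square_integrable_diff P d)
  then have "p \<in> square_integrable M"
    by simp
  moreover have "(\<lambda>k. sq_norm M (\<lambda>x. P (s k) x - p x)) \<longlonglongrightarrow> 0"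
    by (rule tendsto_sandwich[OF _ _ tendsto_const LIMSEQ_realpow_zero[of "1/4"]])
      (auto simp: sq_norm_nonneg d)
  ultimately show ?thesis
    using that s lim by blast
qed

text \<open>Only dyadic weights occur, yet they suffice for the parallelogram law, and every
  property of the hull follows by an induction whose single step is a midpoint. The index
  \<open>m\<close> discards an initial segment, so that a sequence picked from the successive hulls
  inherits what holds eventually along \<open>Y\<close>.\<close>

inductive_set midpoint_hull :: "(nat \<Rightarrow> 'a \<Rightarrow> 'b::real_vector) \<Rightarrow> nat \<Rightarrow> ('a \<Rightarrow> 'b) set"
  for Y m where
  base: "m \<le> n \<Longrightarrow> Y n \<in> midpoint_hull Y m"
| midpoint: "f \<in> midpoint_hull Y m \<Longrightarrow> g \<in> midpoint_hull Y m \<Longrightarrow>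
    (\<lambda>x. (1/2) *\<^sub>R (f x + g x)) \<in> midpoint_hull Y m"

lemma midpoint_hull_antimono:
  assumes "m \<le> k" shows "midpoint_hull Y k \<subseteq> midpoint_hull Y m"
proof
  fix f assume "f \<in> midpoint_hull Y k"
  then show "f \<in> midpoint_hull Y m"
    by induction (use assms in \<open>auto intro: midpoint_hull.intros\<close>)
qed

lemma midpoint_hull_square_integrable:
  assumes "\<And>n. Y n \<in> square_integrable M" "f \<in> midpoint_hull Y m"
  shows "f \<in> square_integrable M"
  using assms(2)
  by induction (auto intro!: square_integrable_scaleR square_integrable_add assms(1))

text \<open>An element of the hull is built by finitely many midpoints, so only finitely many null
  sets accumulate. \<open>Q\<close> may depend on the point, which admits constraints relative to a
  limit function.\<close>

lemma midpoint_hull_AE: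
  assumes f: "f \<in> midpoint_hull Y m" and Y: "\<And>n. m \<le> n \<Longrightarrow> AE x in M. Q x (Y n x)"
    and mid: "\<And>x a b. Q x a \<Longrightarrow> Q x b \<Longrightarrow> Q x ((1/2) *\<^sub>R (a + b))"
  shows "AE x in M. Q x (f x)"
  using f
proof induction
  case (base n)
  then show ?case by (rule Y)
next
  case (midpoint f g)
  from midpoint(3,4) show ?case
    by eventually_elim (rule mid)
qed

text \<open>Near-minimisers of the norm over the hulls of the tails form a Cauchy sequence by the
  parallelogram law.\<close>

theorem midpoint_hull_converges:
  fixes Y :: "nat \<Rightarrow> 'a \<Rightarrow> 'b::euclidean_space"
  assumes Y: "\<And>n. Y n \<in> square_integrable M" and B: "\<And>n. sq_norm M (Y n) \<le> B"
  obtains P p where "\<And>m. P m \<in> midpoint_hull Y m" "p \<in> square_integrable M"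
    "AE x in M. (\<lambda>m. P m x) \<longlonglongrightarrow> p x"
    "(\<lambda>m. sq_norm M (\<lambda>x. P m x - p x)) \<longlonglongrightarrow> 0"
proof -
  \<comment> \<open>The hulls shrink with \<open>m\<close>, so \<open>d\<close> increases; it is
    bounded by \<open>B\<close> since \<open>Y m\<close> lies in the hull. Hence it converges,
    whether or not the infima are attained.\<close>
  define d where "d = (\<lambda>m. INF f\<in>midpoint_hull Y m. sq_norm M f)"
  have bdd: "bdd_below (sq_norm M ` midpoint_hull Y m)" for m
    using sq_norm_nonneg by (intro bdd_belowI2[where m = 0]) auto
  have ne: "midpoint_hull Y m \<noteq> {}" for m
    using midpoint_hull.base[of m m Y] by auto
  have d_le: "d m \<le> sq_norm M f" if "f \<in> midpoint_hull Y m" for f m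
    unfolding d_def using that bdd by (rule cINF_lower[rotated])
  have d_mono: "d m \<le> d k" if "m \<le> k" for m k
    unfolding d_def using that
    by (intro cINF_superset_mono ne bdd midpoint_hull_antimono) auto
  have "d m \<le> B" for m
    using d_le[OF midpoint_hull.base[of m m]] B[of m] by simp
  moreover have "d 0 \<le> d m" for m
    by (rule d_mono) simp
  ultimately have "norm (d m) \<le> \<bar>d 0\<bar> + \<bar>B\<bar>" for m
    by (smt (verit) real_norm_def)
  then have "Bseq d"
    by (rule BseqI')
  then have conv: "convergent d"
    using d_mono by (intro Bseq_mono_convergent) auto
  have "\<exists>f\<in>midpoint_hull Y m. sq_norm M f < d m + 1 / real (Suc m)" for m
    using cINF_less_iff[OF ne bdd, of m "d m + 1 / real (Suc m)"] by (simp add: d_def)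
  then obtain Q where Q: "\<And>m. Q m \<in> midpoint_hull Y m"
    and Q_less: "\<And>m. sq_norm M (Q m) < d m + 1 / real (Suc m)"
    by metis
  have QL: "Q m \<in> square_integrable M" for m
    using midpoint_hull_square_integrable[OF Y Q] .
  have Q_diff: "sq_norm M (\<lambda>x. Q m x - Q k x) \<le> 2 * \<bar>d k - d m\<bar> + 2 / real (Suc m) + 2 / real (Suc k)"
    if "m \<le> k" for m k
  proof -
    \<comment> \<open>Both functions lie in the larger of the two hulls, hence so does their
      midpoint, whose squared norm is therefore at least \<open>d m\<close>.\<close>
    have "(\<lambda>x. (1/2) *\<^sub>R (Q m x + Q k x)) \<in> midpoint_hull Y m"
      using midpoint_hull_antimono[OF that] Q by (blast intro: midpoint_hull.midpoint)
    then have "4 * d m \<le> 4 * sq_norm M (\<lambda>x. (1/2) *\<^sub>R (Q m x + Q k x))"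
      using d_le by simp
    moreover have "2 * sq_norm M (Q m) \<le> 2 * d m + 2 / real (Suc m)"
      "2 * sq_norm M (Q k) \<le> 2 * d k + 2 / real (Suc k)"
      using Q_less[of m] Q_less[of k] by (simp_all add: field_simps)
    moreover have "2 * (d k - d m) \<le> 2 * \<bar>d k - d m\<bar>"
      by (intro mult_left_mono abs_ge_self) simp
    ultimately show ?thesis
      unfolding sq_norm_parallelogram[OF QL QL] by argo
  qed
  have "\<exists>N. \<forall>m\<ge>N. \<forall>n\<ge>N. sq_norm M (\<lambda>x. Q m x - Q n x) \<le> e" if "0 < e" for e
  proof -
    have "Cauchy d"
      using conv by (simp add: Cauchy_convergent_iff)
    \<comment> \<open>Three terms, each twice a quantity below \<open>e / 8\<close>, stay below
      \<open>e\<close>.\<close>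
    then obtain N1 where N1: "\<And>m n. m \<ge> N1 \<Longrightarrow> n \<ge> N1 \<Longrightarrow> \<bar>d m - d n\<bar> < e / 8"
      using \<open>0 < e\<close> unfolding Cauchy_def dist_real_def by (metis divide_pos_pos zero_less_numeral)
    obtain N2 where N2: "1 / real (Suc N2) < e / 8"
      using \<open>0 < e\<close> by (metis divide_pos_pos inverse_eq_divide reals_Archimedean zero_less_numeral)
    have *: "sq_norm M (\<lambda>x. Q m x - Q n x) \<le> e" if "m \<ge> max N1 N2" "n \<ge> max N1 N2" "m \<le> n" for m n
    proof -
      have "1 / real (Suc m) \<le> 1 / real (Suc N2)" "1 / real (Suc n) \<le> 1 / real (Suc N2)"
        using that by (auto intro!: divide_left_mono)
      moreover have "\<bar>d n - d m\<bar> < e / 8"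
        using that by (intro N1) auto
      moreover have "2 / real (Suc m) = 2 * (1 / real (Suc m))" "2 / real (Suc n) = 2 * (1 / real (Suc n))"
        by simp_all
      ultimately show ?thesis
        using Q_diff[OF that(3)] N2 by argo
    qed
    have sym: "sq_norm M (\<lambda>x. Q m x - Q n x) = sq_norm M (\<lambda>x. Q n x - Q m x)" for m n
      by (simp add: sq_norm_def norm_minus_commute)
    show ?thesis
    proof (intro exI[of _ "max N1 N2"] allI impI)
      fix m n assume "m \<ge> max N1 N2" "n \<ge> max N1 N2"
      then show "sq_norm M (\<lambda>x. Q m x - Q n x) \<le> e"
        using *[of m n] *[of n m] sym[of m n] by (cases "m \<le> n") auto
    qed
  qed
  from Riesz_Fischer[OF QL this] obtain s p where s: "strict_mono s"
    and p: "p \<in> square_integrable M" "AE x in M. (\<lambda>k. Q (s k) x) \<longlonglongrightarrow> p x"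
      "(\<lambda>k. sq_norm M (\<lambda>x. Q (s k) x - p x)) \<longlonglongrightarrow> 0"
    by blast
  show ?thesis
  proof (rule that[of "\<lambda>m. Q (s m)" p])
    show "Q (s m) \<in> midpoint_hull Y m" for m
      using midpoint_hull_antimono[OF strict_mono_imp_increasing[OF s]] Q by blast
  qed (use p in auto)
qed

section \<open>Test functions on the circle\<close>

text \<open>Lebesgue measure on one closed period. Both ends stand for the same point of the circle,
  which is harmless because points are null sets.\<close>

definition circle_measure :: "real measure" where
  "circle_measure = restrict_space lborel {0..2*pi}"

lemma space_circle_measure [simp]: "space circle_measure = {0..2*pi}"
  by (simp add: circle_measure_def space_restrict_space)

lemma borel_measurable_circle_measure [measurable (raw)]:
  "f \<in> borel_measurable borel \<Longrightarrow> f \<in> borel_measurable circle_measure"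
  unfolding circle_measure_def by (intro measurable_restrict_space1) simp

lemma finite_measure_circle [simp]: "finite_measure circle_measure"
proof
  show "emeasure circle_measure (space circle_measure) \<noteq> \<infinity>"
    using emeasure_restrict_space[of "{0..2*pi}" lborel "{0..2*pi}"]
    by (simp add: circle_measure_def space_restrict_space)
qed

interpretation circle: finite_measure circle_measure
  by (rule finite_measure_circle)

lemma measure_circle [simp]: "measure circle_measure {0..2*pi} = 2 * pi"
  by (simp add: circle_measure_def measure_restrict_space)

lemma integral_circle_measure:
  fixes f :: "real \<Rightarrow> 'b::{banach, second_countable_topology}"
  shows "(LINT \<theta>:{0..2*pi}|lborel. f \<theta>) = integral\<^sup>L circle_measure f"
  by (simp add: circle_measure_def integral_restrict_space set_lebesgue_integral_def)

lemma integrable_circle_measure: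
  fixes f :: "real \<Rightarrow> 'b::{banach, second_countable_topology}"
  shows "set_integrable lborel {0..2*pi} f \<longleftrightarrow> integrable circle_measure f"
  by (simp add: circle_measure_def integrable_restrict_space set_integrable_def)

lemma AE_circle_measure:
  "(AE x in circle_measure. Q x) \<longleftrightarrow> (AE x in lborel. x \<in> {0..2*pi} \<longrightarrow> Q x)"
  unfolding circle_measure_def by (rule AE_restrict_space_iff) simp

lemma AE_circle_measure_interior: "AE x in circle_measure. x \<in> {0<..<2*pi}"
  unfolding AE_circle_measure
  using AE_lborel_singleton[of "0::real"] AE_lborel_singleton[of "2 * pi"]
  by eventually_elim auto

lemma integrable_circle_mult:
  fixes f :: "real \<Rightarrow> 'b::{banach, second_countable_topology}"
  assumes \<psi>: "continuous_on {0..2*pi} \<psi>" and f: "integrable circle_measure f"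
  shows "integrable circle_measure (\<lambda>x. \<psi> x *\<^sub>R f x :: 'b)"
proof -
  have "bounded (\<psi> ` {0..2*pi})"
    by (intro compact_imp_bounded compact_continuous_image \<psi>) simp
  then obtain K where K: "\<forall>x\<in>{0..2*pi}. \<bar>\<psi> x\<bar> \<le> K"
    by (auto simp: bounded_iff)
  have m: "\<psi> \<in> borel_measurable circle_measure"
    unfolding circle_measure_def using \<psi>
    by (simp add: borel_measurable_continuous_on_restrict cong: measurable_cong_sets
        sets_restrict_space_cong[OF sets_lborel])
  show ?thesis
  proof (rule Bochner_Integration.integrable_bound)
    show "integrable circle_measure (\<lambda>x. K * norm (f x))"
      using f by simp
    show "(\<lambda>x. \<psi> x *\<^sub>R f x) \<in> borel_measurable circle_measure"
      using m f by auto
    show "AE x in circle_measure. norm (\<psi> x *\<^sub>R f x) \<le> norm (K * norm (f x))"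
    proof (rule AE_I2)
      fix x assume "x \<in> space circle_measure"
      then have "\<bar>\<psi> x\<bar> * norm (f x) \<le> K * norm (f x)"
        using K by (intro mult_right_mono) simp_all
      then show "norm (\<psi> x *\<^sub>R f x) \<le> norm (K * norm (f x))"
        by simp
    qed
  qed
qed

text \<open>The derivative of \<open>cis t\<close> is \<open>\<i> * cis t\<close>, again linear in
  \<open>cis t\<close>; with the sum and product rules, trigonometric polynomials are closed under
  differentiation.\<close>

lemma real_polynomial_function_cis_deriv:
  assumes "real_polynomial_function p"
  shows "\<exists>q. real_polynomial_function q \<and>
    (\<forall>t. ((\<lambda>t. p (cis t)) has_real_derivative q (cis t)) (at t))"
  using assms
proof induction
  case (linear f)
  have "real_polynomial_function (\<lambda>z. f (\<i> * z))"
    using bounded_linear_compose[OF linear bounded_linear_mult_right]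
    by (rule real_polynomial_function.intros)
  moreover have "((\<lambda>t. f (cis t)) has_real_derivative f (\<i> * cis t)) (at t)" for t
  proof -
    have "((\<lambda>t. f (cis t)) has_derivative (\<lambda>h. f (h *\<^sub>R (\<i> * cis t)))) (at t)"
      by (intro bounded_linear.has_derivative[OF linear] has_derivative_cis has_derivative_ident)
    moreover have "(\<lambda>h. f (h *\<^sub>R (\<i> * cis t))) = (*) (f (\<i> * cis t))"
      by (rule ext) (metis linear_scale[OF bounded_linear.linear[OF linear]] mult.commute real_scaleR_def)
    ultimately show ?thesis
      by (simp add: has_field_derivative_def)
  qed
  ultimately show ?case
    by (intro exI[of _ "\<lambda>z. f (\<i> * z)"] conjI allI)
next
  case (const c)
  show ?case
    by (rule exI[of _ "\<lambda>_. 0"]) (simp add: real_polynomial_function.intros(2))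
next
  case (add f g)
  then obtain f' g' where "real_polynomial_function f'" "real_polynomial_function g'"
    and d: "\<forall>t. ((\<lambda>t. f (cis t)) has_real_derivative f' (cis t)) (at t)"
      "\<forall>t. ((\<lambda>t. g (cis t)) has_real_derivative g' (cis t)) (at t)"
    by (elim exE conjE)
  then have "real_polynomial_function (\<lambda>z. f' z + g' z)"
    by (intro real_polynomial_function.intros(3))
  moreover have "((\<lambda>t. f (cis t) + g (cis t)) has_real_derivative f' (cis t) + g' (cis t)) (at t)" for t
    by (intro DERIV_add d[rule_format])
  ultimately show ?case
    by (intro exI[of _ "\<lambda>z. f' z + g' z"] conjI allI)
next
  case (mult f g)
  then obtain f' g' where "real_polynomial_function f'" "real_polynomial_function g'"
    and d: "\<forall>t. ((\<lambda>t. f (cis t)) has_real_derivative f' (cis t)) (at t)"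
      "\<forall>t. ((\<lambda>t. g (cis t)) has_real_derivative g' (cis t)) (at t)"
    by (elim exE conjE)
  then have "real_polynomial_function (\<lambda>z. f' z * g z + g' z * f z)"
    using mult by (intro real_polynomial_function.intros(3,4))
  moreover have "((\<lambda>t. f (cis t) * g (cis t)) has_real_derivative
      f' (cis t) * g (cis t) + g' (cis t) * f (cis t)) (at t)" for t
    by (intro DERIV_mult d[rule_format])
  ultimately show ?case
    by (intro exI[of _ "\<lambda>z. f' z * g z + g' z * f z"] conjI allI)
qed

text \<open>Smoothness holds because every iterated derivative is again a polynomial in
  \<open>cis t\<close>. Trigonometric polynomials thus serve as test functions, and no bump
  functions have to be constructed.\<close>

lemma circle_test_real_polynomial_function:
  assumes "real_polynomial_function p"
  shows "circle_test (\<lambda>t. p (cis t))"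
proof -
  have "\<exists>q. real_polynomial_function q \<and> (deriv ^^ n) (\<lambda>t. p (cis t)) = (\<lambda>t. q (cis t))" for n
  proof (induction n)
    case 0
    show ?case by (rule exI[of _ p]) (simp add: assms)
  next
    case (Suc n)
    then obtain q where "real_polynomial_function q" and q: "(deriv ^^ n) (\<lambda>t. p (cis t)) = (\<lambda>t. q (cis t))"
      by metis
    then obtain q' where "real_polynomial_function q'"
      and "\<And>t. ((\<lambda>t. q (cis t)) has_real_derivative q' (cis t)) (at t)"
      using real_polynomial_function_cis_deriv by metis
    then show ?case
      by (intro exI[of _ q'] conjI ext) (simp_all add: q DERIV_imp_deriv)
  qed
  note iterated = this
  have "(deriv ^^ n) (\<lambda>t. p (cis t)) differentiable (at t)" for n t
  proof -
    obtain q where "real_polynomial_function q" and q: "(deriv ^^ n) (\<lambda>t. p (cis t)) = (\<lambda>t. q (cis t))"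
      using iterated by metis
    then obtain q' where "\<And>t. ((\<lambda>t. q (cis t)) has_real_derivative q' (cis t)) (at t)"
      using real_polynomial_function_cis_deriv by metis
    then show ?thesis
      unfolding q real_differentiable_def by (intro exI)
  qed
  moreover have "cis (t + 2 * pi) = cis t" for t
    by (simp add: complex_eq_iff)
  ultimately show ?thesis
    by (simp add: circle_test_def)
qed

text \<open>A continuous function with equal end values descends to the unit circle, where
  Stone-Weierstrass supplies polynomials in the two coordinates; these pull back to trigonometric
  polynomials.\<close>

lemma circle_test_approx:
  fixes \<psi> :: "real \<Rightarrow> real"
  assumes \<psi>: "continuous_on {0..2*pi} \<psi>" and ends: "\<psi> 0 = \<psi> (2*pi)" and e: "0 < e"
  obtains \<phi> where "circle_test \<phi>" "\<And>t. t \<in> {0..2*pi} \<Longrightarrow> \<bar>\<psi> t - \<phi> t\<bar> < e"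
proof -
  define p where "p = (\<lambda>s. \<psi> (2 * pi * s))"
  have "path p"
    unfolding path_def p_def by (intro continuous_on_compose2[OF \<psi>] continuous_intros) auto
  \<comment> \<open>The trivial homotopy is a device: the passage from homotopic loops to homotopic
    circle maps contains the continuity of the induced map, also at 1, where \<open>Arg2pi\<close>
    jumps.\<close>
  then have "homotopic_loops UNIV p p"
    by (simp add: homotopic_loops_refl pathstart_def pathfinish_def p_def ends)
  from homotopic_loops_imp_homotopic_circlemaps[OF this]
  have cont: "continuous_on (sphere 0 1) (p \<circ> (\<lambda>z. Arg2pi z / (2 * pi)))"
    using homotopic_with_imp_continuous by blast
  obtain q where q: "real_polynomial_function q"
    and approx: "\<And>z. z \<in> sphere 0 1 \<Longrightarrow> \<bar>(p \<circ> (\<lambda>z. Arg2pi z / (2 * pi))) z - q z\<bar> < e"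
    using Stone_Weierstrass_real_polynomial_function[OF compact_sphere cont e] by metis
  show ?thesis
  proof (rule that[OF circle_test_real_polynomial_function[OF q]])
    fix t assume t: "t \<in> {0..2*pi}"
    have "(p \<circ> (\<lambda>z. Arg2pi z / (2 * pi))) (cis t) = \<psi> t"
    proof (cases "t = 2 * pi")
      case True
      have "Arg2pi 1 = 0"
        by (rule Arg2pi_unique[of 1]) auto
      then show ?thesis by (simp add: p_def ends True)
    next
      case False
      have "Arg2pi (cis t) = t"
        by (rule Arg2pi_unique[of 1]) (use t False in \<open>auto simp: cis_conv_exp\<close>)
      then show ?thesis by (simp add: p_def)
    qed
    then show "\<bar>\<psi> t - q (cis t)\<bar> < e"
      using approx[of "cis t"] by simp
  qed
qed

lemma circle_test_differentiable:
  assumes "circle_test \<phi>"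
  shows "(\<phi> has_real_derivative deriv \<phi> t) (at t)"
proof -
  have "((deriv ^^ 0) \<phi>) differentiable (at t)"
    using assms unfolding circle_test_def by blast
  then show ?thesis
    by (simp add: DERIV_deriv_iff_real_differentiable)
qed

lemma circle_test_continuous: "circle_test \<phi> \<Longrightarrow> continuous_on S \<phi>"
  by (meson DERIV_continuous circle_test_differentiable continuous_at_imp_continuous_on)

text \<open>Used with \<open>y\<close> the distance to an end of the period: the truncated ramps
  vanish at that end and are eventually 1 at every interior point.\<close>

lemma tendsto_cutoff:
  fixes y :: real
  assumes "0 < y"
  shows "(\<lambda>n. max 0 (min 1 (real n * y))) \<longlonglongrightarrow> 1"
proof (rule tendsto_eventually)
  obtain n0 where n0: "1 < real n0 * y"
    using reals_Archimedean3[OF assms] by blast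
  show "\<forall>\<^sub>F n in sequentially. max 0 (min 1 (real n * y)) = 1"
    using eventually_ge_at_top[of n0]
  proof eventually_elim
    case (elim n)
    then have "real n0 * y \<le> real n * y"
      using assms by (intro mult_right_mono) simp_all
    then have "1 \<le> real n * y"
      using n0 by (rule order_trans[OF less_imp_le, rotated])
    then show ?case
      by (simp only: min_absorb1)
  qed
qed

text \<open>Testing with the sign of \<open>d\<close> would show that the integral of
  \<open>\<bar>d\<bar>\<close> vanishes. The sign is reached in two stages: uniform approximation
  extends the hypothesis to continuous functions with equal end values, and dominated convergence
  carries it from these to the sign.\<close>

lemma circle_fundamental_lemma_real:
  fixes d :: "real \<Rightarrow> real"
  assumes d: "integrable circle_measure d"
    and test: "\<And>\<phi>. circle_test \<phi> \<Longrightarrow> (\<integral>x. \<phi> x * d x \<partial>circle_measure) = 0"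
  shows "AE x in circle_measure. d x = 0"
proof -
  have [measurable]: "d \<in> borel_measurable circle_measure"
    using d by simp
  have cont: "(\<integral>x. \<psi> x * d x \<partial>circle_measure) = 0"
    if \<psi>: "continuous_on {0..2*pi} \<psi>" and ends: "\<psi> 0 = \<psi> (2*pi)" for \<psi>
  proof -
    define K where "K = (\<integral>x. \<bar>d x\<bar> \<partial>circle_measure)"
    have int: "integrable circle_measure (\<lambda>x. \<psi> x * d x)"
      using integrable_circle_mult[OF \<psi> d] by simp
    have le_K: "\<bar>\<integral>x. \<psi> x * d x \<partial>circle_measure\<bar> \<le> e * K" if "0 < e" for e
    proof -
      obtain \<phi> where \<phi>: "circle_test \<phi>" "\<And>t. t \<in> {0..2*pi} \<Longrightarrow> \<bar>\<psi> t - \<phi> t\<bar> < e"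
        using circle_test_approx[OF \<psi> ends \<open>0 < e\<close>] by blast
      have int': "integrable circle_measure (\<lambda>x. \<phi> x * d x)"
        using integrable_circle_mult[OF circle_test_continuous[OF \<phi>(1)] d] by simp
      have "(\<integral>x. \<psi> x * d x \<partial>circle_measure) = (\<integral>x. (\<psi> x - \<phi> x) * d x \<partial>circle_measure)"
        using int int' test[OF \<phi>(1)] by (simp add: left_diff_distrib)
      also have "\<bar>\<dots>\<bar> \<le> (\<integral>x. e * \<bar>d x\<bar> \<partial>circle_measure)"
      proof (rule integral_abs_bound_integral)
        show "integrable circle_measure (\<lambda>x. (\<psi> x - \<phi> x) * d x)"
          using int int' by (simp add: left_diff_distrib)
        show "\<bar>(\<psi> x - \<phi> x) * d x\<bar> \<le> e * \<bar>d x\<bar>" if "x \<in> space circle_measure" for x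
          using \<phi>(2)[of x] that unfolding abs_mult by (intro mult_right_mono) auto
      qed (use d in simp)
      finally show ?thesis
        by (simp add: K_def)
    qed
    have "\<bar>\<integral>x. \<psi> x * d x \<partial>circle_measure\<bar> \<le> e" if "0 < e" for e
    proof -
      have "0 \<le> K" by (simp add: K_def)
      \<comment> \<open>Adding 1 keeps the divisor positive when \<open>K\<close> vanishes.\<close>
      have "\<bar>\<integral>x. \<psi> x * d x \<partial>circle_measure\<bar> \<le> e / (K + 1) * K"
        by (rule le_K) (use \<open>0 \<le> K\<close> that in simp)
      also have "\<dots> \<le> e"
        using \<open>0 \<le> K\<close> that by (simp add: field_simps)
      finally show ?thesis .
    qed
    from this[of "\<bar>\<integral>x. \<psi> x * d x \<partial>circle_measure\<bar> / 2"] show ?thesis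
      by (cases "(\<integral>x. \<psi> x * d x \<partial>circle_measure) = 0") auto
  qed
  define f where "f = (\<lambda>x. indicator {0..2*pi} x *\<^sub>R sgn (d x))"
  have "f \<in> borel_measurable borel"
    using \<open>d \<in> borel_measurable circle_measure\<close>
    unfolding f_def circle_measure_def
    by (subst borel_measurable_restrict_space_iff[symmetric]) (auto cong: measurable_cong_sets
        sets_restrict_space_cong[OF sets_lborel])
  \<comment> \<open>This form of measurability supplies continuous functions converging to
    \<open>f\<close> off a negligible set.\<close>
  then have "f measurable_on UNIV"
    by (intro lebesgue_measurable_imp_measurable_on) (auto intro: measurable_completion)
  then obtain N g where N: "negligible N" and g: "\<And>n. continuous_on UNIV (g n)"
    and g_lim: "\<And>x. x \<notin> N \<Longrightarrow> (\<lambda>n. g n x) \<longlonglongrightarrow> f x"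
    by (auto simp: measurable_on_def)
  \<comment> \<open>Clamping to values between -1 and 1 gives the dominating function
    \<open>\<bar>d\<bar>\<close> and does not move the limit, whose values are signs; the two ramps
    make both end values 0.\<close>
  define \<psi> where "\<psi> = (\<lambda>n x. max (-1) (min 1 (g n x)) * max 0 (min 1 (real n * x)) *
    max 0 (min 1 (real n * (2 * pi - x))))"
  have \<psi>_cont: "continuous_on S (\<psi> n)" for n S
    unfolding \<psi>_def by (intro continuous_intros continuous_on_subset[OF g]) auto
  have \<psi>_le: "\<bar>\<psi> n x\<bar> \<le> 1" for n x
    unfolding \<psi>_def abs_mult by (intro mult_le_one) auto
  have "(\<lambda>n. \<integral>x. \<psi> n x * d x \<partial>circle_measure) \<longlonglongrightarrow> (\<integral>x. \<bar>d x\<bar> \<partial>circle_measure)"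
  proof (rule integral_dominated_convergence)
    show "integrable circle_measure (\<lambda>x. \<bar>d x\<bar>)"
      using d by simp
    show "(\<lambda>x. \<psi> n x * d x) \<in> borel_measurable circle_measure" for n
      using integrable_circle_mult[OF \<psi>_cont d] by (auto dest: borel_measurable_integrable)
    show "AE x in circle_measure. norm (\<psi> n x * d x) \<le> \<bar>d x\<bar>" for n
      using \<psi>_le by (auto simp: abs_mult intro!: mult_left_le_one_le)
    have "AE x in lebesgue. x \<notin> N"
      using N by (simp add: negligible_iff_null_sets AE_not_in)
    then have "AE x in lborel. x \<notin> N"
      by (simp add: AE_completion_iff)
    then have "AE x in circle_measure. x \<notin> N"
      unfolding AE_circle_measure by eventually_elim simp
    then show "AE x in circle_measure. (\<lambda>n. \<psi> n x * d x) \<longlonglongrightarrow> \<bar>d x\<bar>"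
      using AE_circle_measure_interior
    proof eventually_elim
      case (elim x)
      have fx: "f x = sgn (d x)"
        using elim by (simp add: f_def)
      have "(\<lambda>n. \<psi> n x * d x) \<longlonglongrightarrow> max (-1) (min 1 (f x)) * 1 * 1 * d x"
        unfolding \<psi>_def using elim
        by (intro tendsto_mult tendsto_max tendsto_min tendsto_const g_lim tendsto_cutoff) auto
      moreover have "max (-1) (min 1 (f x)) * 1 * 1 * d x = \<bar>d x\<bar>"
        unfolding fx by (simp add: sgn_if)
      ultimately show ?case by simp
    qed
  qed simp
  moreover have "(\<integral>x. \<psi> n x * d x \<partial>circle_measure) = 0" for n
    by (rule cont[OF \<psi>_cont]) (simp add: \<psi>_def)
  ultimately have "(\<integral>x. \<bar>d x\<bar> \<partial>circle_measure) = 0"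
    by (simp add: LIMSEQ_const_iff)
  then show ?thesis
    using d by (subst (asm) integral_nonneg_eq_0_iff_AE) auto
qed

lemma circle_fundamental_lemma:
  fixes d :: "real \<Rightarrow> 'b::euclidean_space"
  assumes d: "integrable circle_measure d"
    and test: "\<And>\<phi>. circle_test \<phi> \<Longrightarrow> (\<integral>x. \<phi> x *\<^sub>R d x \<partial>circle_measure) = 0"
  shows "AE x in circle_measure. d x = 0"
proof -
  have "AE x in circle_measure. d x \<bullet> b = 0" if "b \<in> Basis" for b
  proof (rule circle_fundamental_lemma_real)
    show "integrable circle_measure (\<lambda>x. d x \<bullet> b)"
      using d by simp
    fix \<phi> assume \<phi>: "circle_test \<phi>"
    have "(\<integral>x. \<phi> x * (d x \<bullet> b) \<partial>circle_measure) = (\<integral>x. (\<phi> x *\<^sub>R d x) \<bullet> b \<partial>circle_measure)"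
      by simp
    also have "\<dots> = (\<integral>x. \<phi> x *\<^sub>R d x \<partial>circle_measure) \<bullet> b"
      by (rule integral_inner_left) (intro integrable_circle_mult circle_test_continuous \<phi> d)
    finally show "(\<integral>x. \<phi> x * (d x \<bullet> b) \<partial>circle_measure) = 0"
      by (simp add: test[OF \<phi>])
  qed
  then have "AE x in circle_measure. \<forall>b\<in>Basis. d x \<bullet> b = 0"
    by (intro AE_finite_allI) auto
  then show ?thesis
    by eventually_elim (auto intro: euclidean_eqI)
qed

section \<open>Primitives and weak derivatives\<close>

lemma circle_test_const: "circle_test (\<lambda>_. c)"
  by (rule circle_test_real_polynomial_function) (rule real_polynomial_function.intros)

lemma circle_test_deriv:
  assumes "circle_test \<phi>"
  shows "circle_test (deriv \<phi>)"
  unfolding circle_test_def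
proof (intro conjI allI)
  fix n t
  have "((deriv ^^ Suc n) \<phi>) differentiable (at t)"
    using assms unfolding circle_test_def by blast
  then show "((deriv ^^ n) (deriv \<phi>)) differentiable (at t)"
    by (simp only: funpow_Suc_right o_apply)
  have "(\<phi> has_real_derivative deriv \<phi> (t + 2 * pi)) (at (t + 2 * pi))"
    by (rule circle_test_differentiable[OF assms])
  then have "((\<lambda>x. \<phi> (x + 2 * pi)) has_real_derivative deriv \<phi> (t + 2 * pi)) (at t)"
    by (simp only: DERIV_shift)
  moreover have "(\<lambda>x. \<phi> (x + 2 * pi)) = \<phi>"
    using assms by (simp add: circle_test_def)
  ultimately show "deriv \<phi> (t + 2 * pi) = deriv \<phi> t"
    by (simp add: DERIV_imp_deriv)
qed

lemma circle_test_diff_const: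
  assumes "circle_test \<psi>"
  shows "circle_test (\<lambda>x. \<psi> x - c)"
proof -
  have d: "((\<lambda>x. \<psi> x - c) has_real_derivative deriv \<psi> t) (at t)" for t
    using DERIV_diff[OF circle_test_differentiable[OF assms] DERIV_const] by simp
  then have "deriv (\<lambda>x. \<psi> x - c) = deriv \<psi>"
    by (intro ext DERIV_imp_deriv)
  then have eq: "(deriv ^^ Suc n) (\<lambda>x. \<psi> x - c) = (deriv ^^ Suc n) \<psi>" for n
    by (simp only: funpow_Suc_right o_apply)
  have "((deriv ^^ n) (\<lambda>x. \<psi> x - c)) differentiable (at t)" for n t
  proof (cases n)
    case 0
    then show ?thesis using d by (auto simp: real_differentiable_def)
  next
    case (Suc m)
    then show ?thesis using assms eq[of m] unfolding circle_test_def by metis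
  qed
  then show ?thesis
    using assms by (simp add: circle_test_def)
qed

lemma integral_circle_FTC:
  assumes D: "\<And>t. (\<phi> has_real_derivative f t) (at t)" and f: "continuous_on UNIV f"
    and x: "x \<in> {0..2*pi}"
  shows "(\<integral>s. indicator {x..} s * f s \<partial>circle_measure) = \<phi> (2 * pi) - \<phi> x"
proof -
  have "(\<integral>s. indicator {x..} s * f s \<partial>circle_measure) =
      (\<integral>s. indicator {0..2*pi} s *\<^sub>R (indicator {x..} s * f s) \<partial>lborel)"
    by (simp add: integral_circle_measure[symmetric] set_lebesgue_integral_def)
  also have "\<dots> = (\<integral>s. f s * indicator {x..2*pi} s \<partial>lborel)"
    using x by (intro Bochner_Integration.integral_cong) (auto split: split_indicator)
  also have "\<dots> = \<phi> (2 * pi) - \<phi> x"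
    using x D f by (intro integral_FTC_Icc_real) (auto simp: continuous_on_eq_continuous_at)
  finally show ?thesis .
qed

text \<open>The difference between a primitive and its translate by a period has derivative zero, so
  it is constant; its value at 0 is the integral of \<open>\<psi>\<close> over a period.\<close>

lemma circle_test_antiderivative:
  assumes \<psi>: "circle_test \<psi>" and mean: "(\<integral>x. \<psi> x \<partial>circle_measure) = 0"
  obtains \<phi> where "circle_test \<phi>" "deriv \<phi> = \<psi>"
proof -
  have cont: "continuous_on UNIV \<psi>"
    by (rule circle_test_continuous[OF \<psi>])
  then have "\<exists>\<phi>. \<forall>x::real. -\<infinity> < ereal x \<longrightarrow> ereal x < \<infinity> \<longrightarrow> (\<phi> has_vector_derivative \<psi> x) (at x)"
    by (intro einterval_antiderivative) (auto simp: continuous_on_eq_continuous_at)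
  then obtain \<phi> where D: "\<And>x. (\<phi> has_real_derivative \<psi> x) (at x)"
    by (auto simp: has_real_derivative_iff_has_vector_derivative)
  have deriv: "deriv \<phi> = \<psi>"
    using D by (intro ext DERIV_imp_deriv)
  have "(\<integral>s. indicator {0..} s * \<psi> s \<partial>circle_measure) = (\<integral>x. \<psi> x \<partial>circle_measure)"
    by (rule Bochner_Integration.integral_cong) auto
  then have ends: "\<phi> (2 * pi) = \<phi> 0"
    using integral_circle_FTC[OF D cont, of 0] mean by simp
  have "\<phi> (t + 2 * pi) = \<phi> t" for t
  proof -
    have "((\<lambda>x. \<phi> (x + 2 * pi) - \<phi> x) has_real_derivative 0) (at x)" for x
    proof -
      have "((\<lambda>x. \<phi> (x + 2 * pi)) has_real_derivative \<psi> (x + 2 * pi)) (at x)"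
        using D[of "x + 2 * pi"] by (simp only: DERIV_shift)
      from DERIV_diff[OF this D[of x]] show ?thesis
        using \<psi> by (simp add: circle_test_def)
    qed
    then show ?thesis
      using DERIV_isconst_all[of "\<lambda>x. \<phi> (x + 2 * pi) - \<phi> x" t 0] ends by simp
  qed
  moreover have "((deriv ^^ n) \<phi>) differentiable (at t)" for n t
  proof (cases n)
    case 0
    then show ?thesis using D by (auto simp: real_differentiable_def)
  next
    case (Suc m)
    have "((deriv ^^ m) \<psi>) differentiable (at t)"
      using \<psi> unfolding circle_test_def by blast
    then show ?thesis
      by (simp only: Suc funpow_Suc_right o_apply deriv)
  qed
  ultimately have "circle_test \<phi>"
    by (simp add: circle_test_def)
  then show ?thesis
    using that deriv by blast
qed

text \<open>The integral from 0 to \<open>x\<close> for \<open>x\<close> in the period, written with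
  an indicator so that integration by parts becomes Fubini's theorem on a triangle.\<close>

definition circle_primitive :: "(real \<Rightarrow> 'b::euclidean_space) \<Rightarrow> real \<Rightarrow> 'b" where
  "circle_primitive d x = (\<integral>s. indicator {..x} s *\<^sub>R d s \<partial>circle_measure)"

text \<open>The integrand \<open>deriv \<phi> s *\<^sub>R d x\<close> is integrated over the
  triangle where \<open>x\<close> is at most \<open>s\<close>. One order of integration produces the
  primitive of \<open>d\<close>, the other \<open>\<phi> (2 * pi) - \<phi> x\<close>; the boundary
  term disappears because \<open>d\<close> has mean zero.\<close>

lemma circle_primitive_by_parts:
  assumes d: "integrable circle_measure d" and \<phi>: "circle_test \<phi>"
    and mean: "(\<integral>x. d x \<partial>circle_measure) = 0"
  shows "integrable circle_measure (circle_primitive d)"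
    "(\<integral>x. \<phi> x *\<^sub>R d x \<partial>circle_measure) = - (\<integral>x. deriv \<phi> x *\<^sub>R circle_primitive d x \<partial>circle_measure)"
proof -
  interpret pair_sigma_finite circle_measure circle_measure ..
  have id [measurable]: "(\<lambda>x. x) \<in> circle_measure \<rightarrow>\<^sub>M borel"
    by (intro borel_measurable_circle_measure) simp
  have [measurable]: "d \<in> borel_measurable circle_measure"
    using d by simp
  \<comment> \<open>On the square the integrand is a function of \<open>s\<close> times a function
    of \<open>x\<close>; restricting it to the triangle does not increase its norm.\<close>
  have int: "integrable (circle_measure \<Otimes>\<^sub>M circle_measure)
      (\<lambda>(x, s). of_bool (x \<le> s) *\<^sub>R (f s *\<^sub>R d x))" if f: "continuous_on UNIV f" for f :: "real \<Rightarrow> real"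
  proof -
    have [measurable]: "f \<in> borel_measurable circle_measure"
      using f by (intro borel_measurable_circle_measure borel_measurable_continuous_onI)
    have fi: "integrable circle_measure f"
      using integrable_circle_mult[OF continuous_on_subset[OF f], of "\<lambda>_. 1 :: real"] by simp
    have "integrable (circle_measure \<Otimes>\<^sub>M circle_measure) (\<lambda>(x, s). f s *\<^sub>R d x)"
    proof (rule Fubini_integrable)
      show "integrable circle_measure (\<lambda>x. \<integral>s. norm (case (x, s) of (x, s) \<Rightarrow> f s *\<^sub>R d x) \<partial>circle_measure)"
        using d by simp
      show "AE x in circle_measure. integrable circle_measure (\<lambda>s. case (x, s) of (x, s) \<Rightarrow> f s *\<^sub>R d x)"
        using fi by simp
    qed measurable
    then show ?thesis
      by (rule Bochner_Integration.integrable_bound) (measurable, auto)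
  qed
  have prim: "circle_primitive d s = (\<integral>x. of_bool (x \<le> s) *\<^sub>R d x \<partial>circle_measure)" for s
    unfolding circle_primitive_def by (intro Bochner_Integration.integral_cong) (auto split: split_indicator)
  show "integrable circle_measure (circle_primitive d)"
    using integrable_snd[OF int[of "\<lambda>_. 1"]] by (simp add: prim[abs_def])
  have cont: "continuous_on UNIV (deriv \<phi>)"
    by (intro circle_test_continuous circle_test_deriv \<phi>)
  have inner: "(\<integral>s. of_bool (x \<le> s) *\<^sub>R (deriv \<phi> s *\<^sub>R d x) \<partial>circle_measure) = (\<phi> (2 * pi) - \<phi> x) *\<^sub>R d x"
    if "x \<in> {0..2*pi}" for x
  proof -
    have "(\<integral>s. of_bool (x \<le> s) *\<^sub>R (deriv \<phi> s *\<^sub>R d x) \<partial>circle_measure) =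
        (\<integral>s. (indicator {x..} s * deriv \<phi> s) *\<^sub>R d x \<partial>circle_measure)"
      by (rule Bochner_Integration.integral_cong) (auto split: split_indicator)
    also have "\<dots> = (\<integral>s. indicator {x..} s * deriv \<phi> s \<partial>circle_measure) *\<^sub>R d x"
    proof (rule integral_scaleR_left)
      have "integrable circle_measure (deriv \<phi>)"
        using integrable_circle_mult[OF continuous_on_subset[OF cont], of "\<lambda>_. 1 :: real"] by simp
      then show "integrable circle_measure (\<lambda>s. indicator {x..} s * deriv \<phi> s)"
      proof (rule Bochner_Integration.integrable_bound)
        have [measurable]: "deriv \<phi> \<in> borel_measurable borel"
          using cont by (rule borel_measurable_continuous_onI)
        have "(\<lambda>s. indicator {x..} s * deriv \<phi> s) \<in> borel_measurable borel"
          by measurable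
        then show "(\<lambda>s. indicator {x..} s * deriv \<phi> s) \<in> borel_measurable circle_measure"
          by (rule borel_measurable_circle_measure)
      qed (auto split: split_indicator)
    qed
    also have "\<dots> = (\<phi> (2 * pi) - \<phi> x) *\<^sub>R d x"
      using integral_circle_FTC[of \<phi> "deriv \<phi>" x] circle_test_differentiable[OF \<phi>] cont that by metis
    finally show ?thesis .
  qed
  have \<phi>d: "integrable circle_measure (\<lambda>x. \<phi> x *\<^sub>R d x)"
    by (intro integrable_circle_mult circle_test_continuous \<phi> d)
  have "(\<integral>x. deriv \<phi> x *\<^sub>R circle_primitive d x \<partial>circle_measure) =
      (\<integral>s. \<integral>x. of_bool (x \<le> s) *\<^sub>R (deriv \<phi> s *\<^sub>R d x) \<partial>circle_measure \<partial>circle_measure)"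
  proof (rule Bochner_Integration.integral_cong)
    fix s
    have "deriv \<phi> s *\<^sub>R circle_primitive d s =
        (\<integral>x. deriv \<phi> s *\<^sub>R (of_bool (x \<le> s) *\<^sub>R d x) \<partial>circle_measure)"
      unfolding prim by (rule integral_scaleR_right[symmetric])
    also have "\<dots> = (\<integral>x. of_bool (x \<le> s) *\<^sub>R (deriv \<phi> s *\<^sub>R d x) \<partial>circle_measure)"
      by (rule Bochner_Integration.integral_cong[OF refl], subst scaleR_left_commute, rule refl)
    finally show "deriv \<phi> s *\<^sub>R circle_primitive d s =
        (\<integral>x. of_bool (x \<le> s) *\<^sub>R (deriv \<phi> s *\<^sub>R d x) \<partial>circle_measure)" .
  qed simp
  also have "\<dots> = (\<integral>x. \<integral>s. of_bool (x \<le> s) *\<^sub>R (deriv \<phi> s *\<^sub>R d x) \<partial>circle_measure \<partial>circle_measure)"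
    using int[OF cont]
    by (rule Fubini_integral[where f = "\<lambda>x s. of_bool (x \<le> s) *\<^sub>R (deriv \<phi> s *\<^sub>R d x)"])
  also have "\<dots> = (\<integral>x. (\<phi> (2 * pi) - \<phi> x) *\<^sub>R d x \<partial>circle_measure)"
    by (rule Bochner_Integration.integral_cong[OF refl], rule inner, simp)
  also have "\<dots> = (\<integral>x. \<phi> (2 * pi) *\<^sub>R d x \<partial>circle_measure) - (\<integral>x. \<phi> x *\<^sub>R d x \<partial>circle_measure)"
    using d \<phi>d by (simp add: scaleR_left_diff_distrib)
  finally show "(\<integral>x. \<phi> x *\<^sub>R d x \<partial>circle_measure) = - (\<integral>x. deriv \<phi> x *\<^sub>R circle_primitive d x \<partial>circle_measure)"
    using mean by simp
qed

text \<open>The du Bois-Reymond lemma on the circle: \<open>g\<close> minus the primitive of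
  \<open>d\<close> has weak derivative zero, and such a function is equal to its mean.\<close>

lemma weak_deriv_representation:
  assumes g: "integrable circle_measure g" and d: "integrable circle_measure d"
    and weak: "\<And>\<phi>. circle_test \<phi> \<Longrightarrow>
      (\<integral>x. deriv \<phi> x *\<^sub>R g x \<partial>circle_measure) = - (\<integral>x. \<phi> x *\<^sub>R d x \<partial>circle_measure)"
  obtains c where "AE x in circle_measure. g x = c + circle_primitive d x"
proof -
  \<comment> \<open>The constant test function expresses that a periodic function has no net
    increment over a period.\<close>
  have mean: "(\<integral>x. d x \<partial>circle_measure) = 0"
    using weak[OF circle_test_const[of 1]] by simp
  define u where "u = (\<lambda>x. g x - circle_primitive d x)"
  have u: "integrable circle_measure u"
    unfolding u_def
    by (intro Bochner_Integration.integrable_diff g circle_primitive_by_parts(1)[OF d circle_test_const[of 0] mean])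
  have u_deriv: "(\<integral>x. deriv \<phi> x *\<^sub>R u x \<partial>circle_measure) = 0" if \<phi>: "circle_test \<phi>" for \<phi>
  proof -
    have "integrable circle_measure (\<lambda>x. deriv \<phi> x *\<^sub>R g x)"
      "integrable circle_measure (\<lambda>x. deriv \<phi> x *\<^sub>R circle_primitive d x)"
      by (intro integrable_circle_mult circle_test_continuous circle_test_deriv \<phi> g
          circle_primitive_by_parts(1)[OF d \<phi> mean])+
    then show ?thesis
      using weak[OF \<phi>] circle_primitive_by_parts(2)[OF d \<phi> mean] by (simp add: u_def scaleR_right_diff_distrib)
  qed
  define c where "c = (1 / (2 * pi)) *\<^sub>R (\<integral>x. u x \<partial>circle_measure)"
  have "AE x in circle_measure. u x - c = 0"
  proof (rule circle_fundamental_lemma)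
    show "integrable circle_measure (\<lambda>x. u x - c)"
      using u by simp
    fix \<psi> assume \<psi>: "circle_test \<psi>"
    \<comment> \<open>\<open>a\<close> is the mean of \<open>\<psi>\<close>; once it is subtracted,
      the result is the derivative of a test function and pairs to zero with
      \<open>u\<close>.\<close>
    define a where "a = (\<integral>x. \<psi> x \<partial>circle_measure) / (2 * pi)"
    have \<psi>i: "integrable circle_measure \<psi>"
      using integrable_circle_mult[OF circle_test_continuous[OF \<psi>], of "\<lambda>_. 1 :: real"] by simp
    have "(\<integral>x. \<psi> x - a \<partial>circle_measure) = 0"
      using \<psi>i by (simp add: a_def)
    then obtain \<phi> where "circle_test \<phi>" "deriv \<phi> = (\<lambda>x. \<psi> x - a)"
      using circle_test_antiderivative[OF circle_test_diff_const[OF \<psi>]] by metis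
    then have "(\<integral>x. (\<psi> x - a) *\<^sub>R u x \<partial>circle_measure) = 0"
      using u_deriv by metis
    moreover have \<psi>u: "integrable circle_measure (\<lambda>x. \<psi> x *\<^sub>R u x)"
      by (intro integrable_circle_mult circle_test_continuous \<psi> u)
    ultimately have "(\<integral>x. \<psi> x *\<^sub>R u x \<partial>circle_measure) = a *\<^sub>R (\<integral>x. u x \<partial>circle_measure)"
      using u by (simp add: scaleR_left_diff_distrib)
    also have "\<dots> = (\<integral>x. \<psi> x \<partial>circle_measure) *\<^sub>R c"
      by (simp add: a_def c_def)
    also have "\<dots> = (\<integral>x. \<psi> x *\<^sub>R c \<partial>circle_measure)"
      by (rule integral_scaleR_left[symmetric]) (rule \<psi>i)
    finally show "(\<integral>x. \<psi> x *\<^sub>R (u x - c) \<partial>circle_measure) = 0"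
      using \<psi>u \<psi>i by (simp add: scaleR_right_diff_distrib)
  qed
  then have "AE x in circle_measure. g x = c + circle_primitive d x"
    by eventually_elim (simp add: u_def algebra_simps)
  then show ?thesis by (rule that)
qed

lemma circle_primitive_holder:
  assumes d: "d \<in> square_integrable circle_measure" and "0 \<le> s" "s \<le> t" "t \<le> 2 * pi"
  shows "norm (circle_primitive d t - circle_primitive d s) \<le> sqrt ((t - s) * sq_norm circle_measure d)"
proof -
  have sets: "{s<..t} \<inter> {0..2*pi} \<in> sets circle_measure" for s t
    by (auto simp: circle_measure_def sets_restrict_space intro!: image_eqI[where x = "{s<..t}"])
  have di: "integrable circle_measure d"
    by (rule circle.integral_norm_le[OF d])
  have ind: "integrable circle_measure (\<lambda>x. indicator {..r} x *\<^sub>R d x)" for r :: real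
  proof (rule Bochner_Integration.integrable_bound[OF di])
    have "(\<lambda>s. indicator {..r} s :: real) \<in> borel_measurable circle_measure"
      by (intro borel_measurable_circle_measure) simp
    then show "(\<lambda>x. indicator {..r} x *\<^sub>R d x) \<in> borel_measurable circle_measure"
      using di by (intro borel_measurable_scaleR) auto
  qed (auto split: split_indicator)
  have "norm (circle_primitive d t - circle_primitive d s) =
      norm (\<integral>x. indicator {..t} x *\<^sub>R d x - indicator {..s} x *\<^sub>R d x \<partial>circle_measure)"
    by (simp add: circle_primitive_def ind)
  also have "\<dots> \<le> (\<integral>x. norm (indicator {..t} x *\<^sub>R d x - indicator {..s} x *\<^sub>R d x) \<partial>circle_measure)"
    by (rule integral_norm_bound)
  also have "\<dots> = (\<integral>x. indicator ({s<..t} \<inter> {0..2*pi}) x * norm (d x) \<partial>circle_measure)"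
    using assms by (intro Bochner_Integration.integral_cong) (auto split: split_indicator)
  also have "\<dots> \<le> sqrt (measure circle_measure ({s<..t} \<inter> {0..2*pi}) * sq_norm circle_measure d)"
    by (rule circle.set_integral_norm_le[OF d sets])
  also have "{s<..t} \<inter> {0..2*pi} = {s<..t}"
    using assms by auto
  also have "measure circle_measure {s<..t} = t - s"
    using assms unfolding circle_measure_def by (subst measure_restrict_space) auto
  finally show ?thesis .
qed

section \<open>Calculus in the Sobolev space\<close>

lemma circle_L2_iff:
  "g \<in> circle_L2 \<longleftrightarrow> g \<in> borel_measurable borel \<and> (\<forall>\<theta>. g (\<theta> + 2 * pi) = g \<theta>) \<and>
    g \<in> square_integrable circle_measure"
  by (auto simp: circle_L2_def square_integrable_def integrable_circle_measure)

lemma circle_L2_square_integrable: "g \<in> circle_L2 \<Longrightarrow> g \<in> square_integrable circle_measure"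
  by (simp add: circle_L2_iff)

lemma circle_L2_integrable: "g \<in> circle_L2 \<Longrightarrow> integrable circle_measure g"
  by (intro circle.integral_norm_le(1) circle_L2_square_integrable)

lemma circle_L2_lincomb:
  assumes "f \<in> circle_L2" "g \<in> circle_L2"
  shows "(\<lambda>\<theta>. a *\<^sub>R f \<theta> + b *\<^sub>R g \<theta>) \<in> circle_L2"
  using assms by (auto simp: circle_L2_iff intro!: square_integrable_add square_integrable_scaleR)

lemma has_circle_weak_deriv_iff:
  "has_circle_weak_deriv g d \<longleftrightarrow> (\<forall>\<phi>. circle_test \<phi> \<longrightarrow>
    (\<integral>x. deriv \<phi> x *\<^sub>R g x \<partial>circle_measure) = - (\<integral>x. \<phi> x *\<^sub>R d x \<partial>circle_measure))"
  by (simp add: has_circle_weak_deriv_def integral_circle_measure)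

lemma integrable_circle_test:
  assumes "circle_test \<phi>" "integrable circle_measure (f::real \<Rightarrow> 'b::euclidean_space)"
  shows "integrable circle_measure (\<lambda>x. \<phi> x *\<^sub>R f x)"
  using assms by (intro integrable_circle_mult circle_test_continuous)

text \<open>Two candidates have the same integral against every test function. Hence the choice made
  in \<open>weak_deriv\<close> matters only on a null set.\<close>

lemma has_circle_weak_deriv_unique:
  assumes "d \<in> circle_L2" "e \<in> circle_L2" "has_circle_weak_deriv g d" "has_circle_weak_deriv g e"
  shows "AE x in circle_measure. d x = e x"
proof -
  have "AE x in circle_measure. d x - e x = 0"
  proof (rule circle_fundamental_lemma)
    show "integrable circle_measure (\<lambda>x. d x - e x)"
      using assms by (simp add: circle_L2_integrable)
    fix \<phi> assume \<phi>: "circle_test \<phi>"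
    have "(\<integral>x. deriv \<phi> x *\<^sub>R g x \<partial>circle_measure) = - (\<integral>x. \<phi> x *\<^sub>R d x \<partial>circle_measure)"
      "(\<integral>x. deriv \<phi> x *\<^sub>R g x \<partial>circle_measure) = - (\<integral>x. \<phi> x *\<^sub>R e x \<partial>circle_measure)"
      using assms(3,4) \<phi> unfolding has_circle_weak_deriv_iff by blast+
    moreover have "integrable circle_measure (\<lambda>x. \<phi> x *\<^sub>R d x)"
      "integrable circle_measure (\<lambda>x. \<phi> x *\<^sub>R e x)"
      by (rule integrable_circle_test[OF \<phi> circle_L2_integrable], fact)+
    ultimately show "(\<integral>x. \<phi> x *\<^sub>R (d x - e x) \<partial>circle_measure) = 0"
      by (simp add: scaleR_right_diff_distrib)
  qed
  then show ?thesis by eventually_elim simp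
qed

lemma has_circle_weak_deriv_lincomb:
  assumes "f \<in> circle_L2" "d \<in> circle_L2" "has_circle_weak_deriv f d"
    and "g \<in> circle_L2" "e \<in> circle_L2" "has_circle_weak_deriv g e"
  shows "has_circle_weak_deriv (\<lambda>\<theta>. a *\<^sub>R f \<theta> + b *\<^sub>R g \<theta>) (\<lambda>\<theta>. a *\<^sub>R d \<theta> + b *\<^sub>R e \<theta>)"
  unfolding has_circle_weak_deriv_iff
proof (intro allI impI)
  fix \<phi> assume \<phi>: "circle_test \<phi>"
  have lin: "(\<integral>x. \<psi> x *\<^sub>R (a *\<^sub>R u x + b *\<^sub>R v x) \<partial>circle_measure) =
      a *\<^sub>R (\<integral>x. \<psi> x *\<^sub>R u x \<partial>circle_measure) + b *\<^sub>R (\<integral>x. \<psi> x *\<^sub>R v x \<partial>circle_measure)"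
    if "circle_test \<psi>" "u \<in> circle_L2" "v \<in> circle_L2" for \<psi> u v
  proof -
    have "(\<integral>x. \<psi> x *\<^sub>R (a *\<^sub>R u x + b *\<^sub>R v x) \<partial>circle_measure) =
        (\<integral>x. a *\<^sub>R (\<psi> x *\<^sub>R u x) + b *\<^sub>R (\<psi> x *\<^sub>R v x) \<partial>circle_measure)"
      by (rule Bochner_Integration.integral_cong[OF refl])
        (simp only: scaleR_add_right scaleR_left_commute[of "\<psi> _"])
    moreover have "integrable circle_measure (\<lambda>x. \<psi> x *\<^sub>R u x)"
      "integrable circle_measure (\<lambda>x. \<psi> x *\<^sub>R v x)"
      by (rule integrable_circle_test[OF that(1) circle_L2_integrable], fact)+
    ultimately show ?thesis
      by (simp del: scaleR_scaleR)
  qed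
  have "(\<integral>x. deriv \<phi> x *\<^sub>R f x \<partial>circle_measure) = - (\<integral>x. \<phi> x *\<^sub>R d x \<partial>circle_measure)"
    "(\<integral>x. deriv \<phi> x *\<^sub>R g x \<partial>circle_measure) = - (\<integral>x. \<phi> x *\<^sub>R e x \<partial>circle_measure)"
    using assms(3,6) \<phi> unfolding has_circle_weak_deriv_iff by blast+
  then show "(\<integral>x. deriv \<phi> x *\<^sub>R (a *\<^sub>R f x + b *\<^sub>R g x) \<partial>circle_measure) =
      - (\<integral>x. \<phi> x *\<^sub>R (a *\<^sub>R d x + b *\<^sub>R e x) \<partial>circle_measure)"
    unfolding lin[OF \<phi> assms(2,5)] lin[OF circle_test_deriv[OF \<phi>] assms(1,4)] by simp
qed

lemma weak_deriv_W12:
  assumes "g \<in> circle_W12"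
  shows "weak_deriv g \<in> circle_L2" "has_circle_weak_deriv g (weak_deriv g)"
proof -
  have "\<exists>d. d \<in> circle_L2 \<and> has_circle_weak_deriv g d"
    using assms by (auto simp: circle_W12_def)
  from someI_ex[OF this] show "weak_deriv g \<in> circle_L2" "has_circle_weak_deriv g (weak_deriv g)"
    by (simp_all add: weak_deriv_def)
qed

lemma W12_circle_L2: "g \<in> circle_W12 \<Longrightarrow> g \<in> circle_L2"
  by (simp add: circle_W12_def)

lemma weak_deriv_unique:
  assumes "g \<in> circle_W12" "d \<in> circle_L2" "has_circle_weak_deriv g d"
  shows "AE x in circle_measure. weak_deriv g x = d x"
  using has_circle_weak_deriv_unique weak_deriv_W12 assms by blast

text \<open>The rule for the derivative holds only almost everywhere, because
  \<open>weak_deriv\<close> picks a representative separately for each function.\<close>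

lemma W12_lincomb:
  assumes f: "f \<in> circle_W12" and g: "g \<in> circle_W12"
  shows "(\<lambda>\<theta>. a *\<^sub>R f \<theta> + b *\<^sub>R g \<theta>) \<in> circle_W12"
    "AE x in circle_measure. weak_deriv (\<lambda>\<theta>. a *\<^sub>R f \<theta> + b *\<^sub>R g \<theta>) x =
      a *\<^sub>R weak_deriv f x + b *\<^sub>R weak_deriv g x"
proof -
  note L2 = W12_circle_L2[OF f] W12_circle_L2[OF g] weak_deriv_W12[OF f] weak_deriv_W12[OF g]
  have d: "(\<lambda>\<theta>. a *\<^sub>R weak_deriv f \<theta> + b *\<^sub>R weak_deriv g \<theta>) \<in> circle_L2"
    "has_circle_weak_deriv (\<lambda>\<theta>. a *\<^sub>R f \<theta> + b *\<^sub>R g \<theta>) (\<lambda>\<theta>. a *\<^sub>R weak_deriv f \<theta> + b *\<^sub>R weak_deriv g \<theta>)"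
    by (intro circle_L2_lincomb has_circle_weak_deriv_lincomb L2)+
  show W: "(\<lambda>\<theta>. a *\<^sub>R f \<theta> + b *\<^sub>R g \<theta>) \<in> circle_W12"
    unfolding circle_W12_def using d circle_L2_lincomb[OF L2(1,2)] by blast
  show "AE x in circle_measure. weak_deriv (\<lambda>\<theta>. a *\<^sub>R f \<theta> + b *\<^sub>R g \<theta>) x =
      a *\<^sub>R weak_deriv f x + b *\<^sub>R weak_deriv g x"
    by (rule weak_deriv_unique[OF W d])
qed

lemma W12_norm_eq:
  assumes "g \<in> circle_W12"
  shows "W12_norm g = sqrt (sq_norm circle_measure g + sq_norm circle_measure (weak_deriv g))"
proof -
  have "integrable circle_measure (\<lambda>\<theta>. (norm (g \<theta>))\<^sup>2)"
    "integrable circle_measure (\<lambda>\<theta>. (norm (weak_deriv g \<theta>))\<^sup>2)"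
    by (intro square_integrable_integrable circle_L2_square_integrable W12_circle_L2
        weak_deriv_W12 assms)+
  then show ?thesis
    by (simp add: W12_norm_def integral_circle_measure sq_norm_def)
qed

text \<open>The difference of the chosen derivatives replaces the derivative chosen for the
  difference, with which it agrees almost everywhere. The bound gives continuity of \<open>l\<close>
  under L2 convergence of maps and derivatives, and equal values on representatives of one
  class.\<close>

lemma W12_dual_diff_le:
  assumes l: "l \<in> W12_dual"
  obtains K where "\<And>f g. f \<in> circle_W12 \<Longrightarrow> g \<in> circle_W12 \<Longrightarrow> \<bar>l f - l g\<bar> \<le>
    K * sqrt (sq_norm circle_measure (\<lambda>x. f x - g x) +
      sq_norm circle_measure (\<lambda>x. weak_deriv f x - weak_deriv g x))"
proof -
  have add: "\<And>f g. f \<in> circle_W12 \<Longrightarrow> g \<in> circle_W12 \<Longrightarrow> l (\<lambda>\<theta>. f \<theta> + g \<theta>) = l f + l g"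
    and scale: "\<And>c g. g \<in> circle_W12 \<Longrightarrow> l (\<lambda>\<theta>. c *\<^sub>R g \<theta>) = c * l g"
    using l by (simp_all add: W12_dual_def)
  obtain K where K: "\<forall>g\<in>circle_W12. \<bar>l g\<bar> \<le> K * W12_norm g"
    using l unfolding W12_dual_def by blast
  show ?thesis
  proof (rule that[of K])
    fix f g assume f: "f \<in> circle_W12" and g: "g \<in> circle_W12"
    have neg: "(\<lambda>\<theta>. (-1) *\<^sub>R g \<theta>) \<in> circle_W12"
      using W12_lincomb(1)[OF g g, of "-1" 0] by simp
    have d: "(\<lambda>\<theta>. f \<theta> - g \<theta>) \<in> circle_W12"
      "AE x in circle_measure. weak_deriv (\<lambda>\<theta>. f \<theta> - g \<theta>) x = weak_deriv f x - weak_deriv g x"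
      using W12_lincomb[OF f g, of 1 "-1"] by simp_all
    have "l (\<lambda>\<theta>. f \<theta> - g \<theta>) = l f - l g"
      using add[OF f neg] scale[OF g, of "-1"] by simp
    moreover have "sq_norm circle_measure (weak_deriv (\<lambda>\<theta>. f \<theta> - g \<theta>)) =
        sq_norm circle_measure (\<lambda>x. weak_deriv f x - weak_deriv g x)"
      using d f g weak_deriv_W12(1) circle_L2_square_integrable
      by (intro sq_norm_cong_AE borel_measurable_diff square_integrable_measurable) blast+
    ultimately show "\<bar>l f - l g\<bar> \<le> K * sqrt (sq_norm circle_measure (\<lambda>x. f x - g x) +
        sq_norm circle_measure (\<lambda>x. weak_deriv f x - weak_deriv g x))"
      using K[rule_format, OF d(1)] W12_norm_eq[OF d(1)] by simp
  qed
qed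

lemma weak_deriv_cong_AE:
  assumes f: "f \<in> circle_W12" and g: "g \<in> circle_W12" and eq: "AE x in circle_measure. f x = g x"
  shows "AE x in circle_measure. weak_deriv f x = weak_deriv g x"
proof (rule weak_deriv_unique[OF f weak_deriv_W12(1)[OF g]])
  have fm: "f \<in> borel_measurable circle_measure" "g \<in> borel_measurable circle_measure"
    using f g W12_circle_L2 circle_L2_square_integrable square_integrable_measurable by blast+
  have "(\<integral>x. deriv \<phi> x *\<^sub>R f x \<partial>circle_measure) = (\<integral>x. deriv \<phi> x *\<^sub>R g x \<partial>circle_measure)"
    if "circle_test \<phi>" for \<phi>
  proof (rule integral_cong_AE)
    have "deriv \<phi> \<in> borel_measurable circle_measure"
      by (intro borel_measurable_circle_measure borel_measurable_continuous_onI
          circle_test_continuous circle_test_deriv that)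
    then show "(\<lambda>x. deriv \<phi> x *\<^sub>R f x) \<in> borel_measurable circle_measure"
      "(\<lambda>x. deriv \<phi> x *\<^sub>R g x) \<in> borel_measurable circle_measure"
      using fm by auto
    show "AE x in circle_measure. deriv \<phi> x *\<^sub>R f x = deriv \<phi> x *\<^sub>R g x"
      using eq by eventually_elim simp
  qed
  then show "has_circle_weak_deriv f (weak_deriv g)"
    using weak_deriv_W12(2)[OF g] by (simp add: has_circle_weak_deriv_iff)
qed

text \<open>Limits over \<open>circle_measure\<close> are known on one period only, while members of
  \<open>circle_L2\<close> are Borel and periodic on the line. Reducing the argument modulo
  \<open>2 * pi\<close> repairs this; within the period the two functions can differ only at the
  right end.\<close>

lemma circle_periodic_extension:
  fixes f :: "real \<Rightarrow> 'b::euclidean_space"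
  assumes f: "f \<in> borel_measurable circle_measure"
  obtains g where "g \<in> borel_measurable borel" "\<And>\<theta>. g (\<theta> + 2 * pi) = g \<theta>"
    "AE x in circle_measure. f x = g x"
proof -
  define h where "h = (\<lambda>x. indicator {0..2*pi} x *\<^sub>R f x)"
  have [measurable]: "h \<in> borel_measurable borel"
    using f unfolding h_def circle_measure_def
    by (subst borel_measurable_restrict_space_iff[symmetric]) (auto cong: measurable_cong_sets
        sets_restrict_space_cong[OF sets_lborel])
  define g where "g = (\<lambda>x. h (x - 2 * pi * real_of_int \<lfloor>x / (2 * pi)\<rfloor>))"
  have "g \<in> borel_measurable borel"
    unfolding g_def by measurable
  moreover have "g (\<theta> + 2 * pi) = g \<theta>" for \<theta>
  proof -
    have "(\<theta> + 2 * pi) / (2 * pi) = \<theta> / (2 * pi) + 1"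
      by (simp add: field_simps)
    then have "\<lfloor>(\<theta> + 2 * pi) / (2 * pi)\<rfloor> = \<lfloor>\<theta> / (2 * pi)\<rfloor> + 1"
      by simp
    then show ?thesis
      by (simp add: g_def distrib_left)
  qed
  moreover have "AE x in circle_measure. f x = g x"
    using AE_circle_measure_interior
  proof eventually_elim
    case (elim x)
    then have "\<lfloor>x / (2 * pi)\<rfloor> = 0"
      by (intro floor_unique) (auto simp: field_simps)
    then show ?case
      using elim by (simp add: g_def h_def)
  qed
  ultimately show ?thesis
    by (rule that)
qed

lemma tendsto_circle_test_integral:
  fixes f :: "nat \<Rightarrow> real \<Rightarrow> 'b::euclidean_space"
  assumes \<phi>: "circle_test \<phi>" and f: "\<And>n. f n \<in> square_integrable circle_measure"
    and p: "p \<in> square_integrable circle_measure"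
    and lim: "(\<lambda>n. sq_norm circle_measure (\<lambda>x. f n x - p x)) \<longlonglongrightarrow> 0"
  shows "(\<lambda>n. \<integral>x. \<phi> x *\<^sub>R f n x \<partial>circle_measure) \<longlonglongrightarrow> (\<integral>x. \<phi> x *\<^sub>R p x \<partial>circle_measure)"
proof -
  have "bounded (\<phi> ` {0..2*pi})"
    by (intro compact_imp_bounded compact_continuous_image circle_test_continuous \<phi>) simp
  then obtain K where K: "\<forall>x\<in>{0..2*pi}. \<bar>\<phi> x\<bar> \<le> K"
    by (auto simp: bounded_iff)
  have d: "(\<lambda>x. f n x - p x) \<in> square_integrable circle_measure" for n
    by (intro square_integrable_diff f p)
  have "norm ((\<integral>x. \<phi> x *\<^sub>R f n x \<partial>circle_measure) - (\<integral>x. \<phi> x *\<^sub>R p x \<partial>circle_measure)) \<le>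
      K * sqrt (2 * pi * sq_norm circle_measure (\<lambda>x. f n x - p x))" for n
  proof -
    have int: "integrable circle_measure (\<lambda>x. \<phi> x *\<^sub>R f n x)" "integrable circle_measure (\<lambda>x. \<phi> x *\<^sub>R p x)"
      by (intro integrable_circle_test \<phi> circle.integral_norm_le(1) f p)+
    have "0 \<le> K"
      using K[rule_format, of 0] abs_ge_zero[of "\<phi> 0"] by simp
    have "(\<integral>x. \<phi> x *\<^sub>R f n x \<partial>circle_measure) - (\<integral>x. \<phi> x *\<^sub>R p x \<partial>circle_measure) =
        (\<integral>x. \<phi> x *\<^sub>R f n x - \<phi> x *\<^sub>R p x \<partial>circle_measure)"
      using int by simp
    also have "norm \<dots> \<le> (\<integral>x. K * norm (f n x - p x) \<partial>circle_measure)"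
    proof (rule Bochner_Integration.integral_norm_bound_integral)
      show "integrable circle_measure (\<lambda>x. \<phi> x *\<^sub>R f n x - \<phi> x *\<^sub>R p x)"
        using int by simp
      show "integrable circle_measure (\<lambda>x. K * norm (f n x - p x))"
        using circle.integral_norm_le(1)[OF d] by simp
      show "norm (\<phi> x *\<^sub>R f n x - \<phi> x *\<^sub>R p x) \<le> K * norm (f n x - p x)" if "x \<in> space circle_measure" for x
        using K that unfolding scaleR_right_diff_distrib[symmetric] norm_scaleR
        by (intro mult_right_mono) auto
    qed
    also have "\<dots> = K * (\<integral>x. norm (f n x - p x) \<partial>circle_measure)"
      by simp
    also have "\<dots> \<le> K * sqrt (2 * pi * sq_norm circle_measure (\<lambda>x. f n x - p x))"
      using circle.integral_norm_le(2)[OF d[of n]] \<open>0 \<le> K\<close> by (intro mult_left_mono) auto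
    finally show ?thesis .
  qed
  moreover have "(\<lambda>n. K * sqrt (2 * pi * sq_norm circle_measure (\<lambda>x. f n x - p x))) \<longlonglongrightarrow> 0"
    using tendsto_mult_left[OF tendsto_real_sqrt[OF tendsto_mult_left[OF lim, of "2 * pi"]], of K] by simp
  ultimately have "(\<lambda>n. (\<integral>x. \<phi> x *\<^sub>R f n x \<partial>circle_measure) - (\<integral>x. \<phi> x *\<^sub>R p x \<partial>circle_measure)) \<longlonglongrightarrow> 0"
    by (rule Lim_null_comparison[OF always_eventually, OF allI])
  then show ?thesis
    by (rule LIM_zero_cancel)
qed

text \<open>For a fixed test function both sides of the identity defining the weak derivative are
  continuous in L2, so the graph of the derivative is closed. The limits are exchanged for periodic
  Borel representatives, which is why the conclusions hold almost everywhere.\<close>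

lemma circle_W12_closed:
  assumes q: "\<And>m. q m \<in> circle_W12"
    and p: "p \<in> square_integrable circle_measure" "p' \<in> square_integrable circle_measure"
    and lim: "(\<lambda>m. sq_norm circle_measure (\<lambda>x. q m x - p x)) \<longlonglongrightarrow> 0"
      "(\<lambda>m. sq_norm circle_measure (\<lambda>x. weak_deriv (q m) x - p' x)) \<longlonglongrightarrow> 0"
  obtains g where "g \<in> circle_W12" "AE x in circle_measure. g x = p x"
    "AE x in circle_measure. weak_deriv g x = p' x"
proof -
  have ext: "\<exists>g\<in>circle_L2. AE x in circle_measure. f x = g x"
    if f: "f \<in> square_integrable circle_measure" for f
  proof -
    obtain g where g: "g \<in> borel_measurable borel" "\<And>\<theta>. g (\<theta> + 2 * pi) = g \<theta>"
      "AE x in circle_measure. f x = g x"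
      using circle_periodic_extension[OF square_integrable_measurable[OF f]] by metis
    then have "g \<in> square_integrable circle_measure"
      using f by (intro square_integrable_cong_AE[OF f]) (auto intro: borel_measurable_circle_measure)
    then show ?thesis
      using g by (auto simp: circle_L2_iff)
  qed
  obtain g where g: "g \<in> circle_L2" "AE x in circle_measure. p x = g x"
    using ext[OF p(1)] by blast
  obtain d where d: "d \<in> circle_L2" "AE x in circle_measure. p' x = d x"
    using ext[OF p(2)] by blast
  have congr: "(\<lambda>m. sq_norm circle_measure (\<lambda>x. f m x - u x)) = (\<lambda>m. sq_norm circle_measure (\<lambda>x. f m x - v x))"
    if "\<And>m. f m \<in> circle_L2" "u \<in> square_integrable circle_measure" "v \<in> circle_L2"
      "AE x in circle_measure. u x = v x" for u v and f :: "nat \<Rightarrow> real \<Rightarrow> real^2"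
  proof
    fix m
    have [measurable]: "f m \<in> borel_measurable circle_measure" "u \<in> borel_measurable circle_measure"
      "v \<in> borel_measurable circle_measure"
      using that circle_L2_square_integrable square_integrable_measurable by blast+
    have "AE x in circle_measure. f m x - u x = f m x - v x"
      using that(4) by eventually_elim simp
    then show "sq_norm circle_measure (\<lambda>x. f m x - u x) = sq_norm circle_measure (\<lambda>x. f m x - v x)"
      by (intro sq_norm_cong_AE) measurable
  qed
  have lim_g: "(\<lambda>m. sq_norm circle_measure (\<lambda>x. q m x - g x)) \<longlonglongrightarrow> 0"
    using lim(1) congr[OF W12_circle_L2[OF q] p(1) g] by simp
  have lim_d: "(\<lambda>m. sq_norm circle_measure (\<lambda>x. weak_deriv (q m) x - d x)) \<longlonglongrightarrow> 0"
    using lim(2) congr[OF weak_deriv_W12(1)[OF q] p(2) d] by simp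
  have "has_circle_weak_deriv g d"
    unfolding has_circle_weak_deriv_iff
  proof (intro allI impI)
    fix \<phi> assume \<phi>: "circle_test \<phi>"
    have "(\<lambda>m. \<integral>x. deriv \<phi> x *\<^sub>R q m x \<partial>circle_measure) \<longlonglongrightarrow> (\<integral>x. deriv \<phi> x *\<^sub>R g x \<partial>circle_measure)"
      by (intro tendsto_circle_test_integral circle_test_deriv \<phi> circle_L2_square_integrable
          W12_circle_L2 q g lim_g)
    moreover have "(\<integral>x. deriv \<phi> x *\<^sub>R q m x \<partial>circle_measure) = - (\<integral>x. \<phi> x *\<^sub>R weak_deriv (q m) x \<partial>circle_measure)" for m
      using weak_deriv_W12(2)[OF q] \<phi> by (simp add: has_circle_weak_deriv_iff)
    moreover have "(\<lambda>m. - (\<integral>x. \<phi> x *\<^sub>R weak_deriv (q m) x \<partial>circle_measure)) \<longlonglongrightarrow> - (\<integral>x. \<phi> x *\<^sub>R d x \<partial>circle_measure)"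
      by (intro tendsto_minus tendsto_circle_test_integral \<phi> circle_L2_square_integrable
          weak_deriv_W12 q d lim_d)
    ultimately show "(\<integral>x. deriv \<phi> x *\<^sub>R g x \<partial>circle_measure) = - (\<integral>x. \<phi> x *\<^sub>R d x \<partial>circle_measure)"
      using LIMSEQ_unique by simp
  qed
  then have W: "g \<in> circle_W12"
    using g d by (auto simp: circle_W12_def)
  moreover have "AE x in circle_measure. g x = p x"
    using g(2) by eventually_elim simp
  moreover have "AE x in circle_measure. weak_deriv g x = p' x"
    using weak_deriv_unique[OF W d(1) \<open>has_circle_weak_deriv g d\<close>] d(2) by eventually_elim simp
  ultimately show ?thesis
    by (rule that)
qed

section \<open>Compactness\<close>

text \<open>\<open>G\<close> is a constant plus the primitive of the weak derivative; Cauchy-Schwarz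
  on the interval from \<open>s\<close> to \<open>t\<close> gives the exponent 1/2.\<close>

lemma W12_holder_representative:
  assumes g: "g \<in> circle_W12"
  obtains G where "AE x in circle_measure. g x = G x"
    "\<And>s t. 0 \<le> s \<Longrightarrow> s \<le> t \<Longrightarrow> t \<le> 2 * pi \<Longrightarrow>
      norm (G t - G s) \<le> sqrt ((t - s) * sq_norm circle_measure (weak_deriv g))"
proof -
  note d = weak_deriv_W12[OF g]
  obtain c where c: "AE x in circle_measure. g x = c + circle_primitive (weak_deriv g) x"
  proof (rule weak_deriv_representation)
    show "integrable circle_measure g" "integrable circle_measure (weak_deriv g)"
      by (intro circle_L2_integrable W12_circle_L2 g d)+
    show "(\<integral>x. deriv \<phi> x *\<^sub>R g x \<partial>circle_measure) = - (\<integral>x. \<phi> x *\<^sub>R weak_deriv g x \<partial>circle_measure)"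
      if "circle_test \<phi>" for \<phi>
      using d(2) that unfolding has_circle_weak_deriv_iff by blast
  qed (rule that)
  show ?thesis
  proof (rule that[OF c])
    fix s t :: real
    assume st: "0 \<le> s" "s \<le> t" "t \<le> 2 * pi"
    show "norm (c + circle_primitive (weak_deriv g) t - (c + circle_primitive (weak_deriv g) s)) \<le>
        sqrt ((t - s) * sq_norm circle_measure (weak_deriv g))"
      using circle_primitive_holder[OF circle_L2_square_integrable[OF d(1)] st] by simp
  qed
qed

text \<open>If \<open>G\<close> were large at one point, the oscillation bound would make it large
  on the whole period, against the bound on the integral of \<open>norm (g s)\<close>.\<close>

lemma circle_sup_bound:
  fixes g :: "real \<Rightarrow> 'b::euclidean_space"
  assumes g: "g \<in> square_integrable circle_measure" and eq: "AE x in circle_measure. g x = G x"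
    and B: "sq_norm circle_measure g \<le> B"
    and osc: "\<And>s t. s \<in> {0..2*pi} \<Longrightarrow> t \<in> {0..2*pi} \<Longrightarrow> norm (G t - G s) \<le> r"
    and t: "t \<in> {0..2*pi}"
  shows "norm (G t) \<le> sqrt (2 * pi * B) + r"
proof -
  have gi: "integrable circle_measure g"
    by (rule circle.integral_norm_le(1)[OF g])
  have "0 \<le> B"
    using B sq_norm_nonneg order_trans by blast
  have "AE s in circle_measure. norm (G t) - r \<le> norm (g s)"
    using eq AE_circle_measure_interior
  proof eventually_elim
    case (elim s)
    then have "norm (G t) \<le> norm (G s) + r"
      using osc[of s t] t norm_triangle_sub[of "G t" "G s"] by simp
    then show ?case using elim by simp
  qed
  then have "(\<integral>s. norm (G t) - r \<partial>circle_measure) \<le> (\<integral>s. norm (g s) \<partial>circle_measure)"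
    using gi by (intro integral_mono_AE) auto
  also have "\<dots> \<le> sqrt (2 * pi * sq_norm circle_measure g)"
    using circle.integral_norm_le(2)[OF g] by simp
  also have "\<dots> \<le> sqrt (2 * pi * B)"
    using B by (intro real_sqrt_le_mono mult_left_mono) auto
  finally have "2 * pi * (norm (G t) - r) \<le> sqrt (2 * pi * B)"
    by simp
  \<comment> \<open>The factor \<open>2 * pi\<close> is at least 1 and is dropped for a simpler
    bound.\<close>
  moreover have "norm (G t) - r \<le> 2 * pi * (norm (G t) - r)" if "0 \<le> norm (G t) - r"
    using mult_right_mono[of 1 "2 * pi" "norm (G t) - r"] that pi_ge_two by simp
  moreover have "0 \<le> sqrt (2 * pi * B)"
    using \<open>0 \<le> B\<close> by simp
  ultimately show ?thesis
    by linarith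
qed

text \<open>Arzela-Ascoli is applied to the Hoelder continuous representatives, and its conclusions
  are transferred to \<open>X\<close> almost everywhere. \<open>M\<close> bounds the whole sequence,
  while uniform convergence holds along \<open>k\<close>.\<close>

theorem W12_bounded_imp_uniform_subsequence:
  assumes X: "\<And>n. X n \<in> circle_W12"
    and B: "\<And>n. sq_norm circle_measure (X n) \<le> B" "\<And>n. sq_norm circle_measure (weak_deriv (X n)) \<le> B"
  obtains k G M where "strict_mono (k :: nat \<Rightarrow> nat)"
    "\<forall>n. AE x in circle_measure. norm (X n x) \<le> M"
    "\<forall>e>0. \<exists>N. \<forall>n\<ge>N. AE x in circle_measure. norm (X (k n) x - G x) \<le> e"
proof -
  have "\<exists>H. (AE x in circle_measure. X n x = H x) \<and>
      (\<forall>s t. 0 \<le> s \<longrightarrow> s \<le> t \<longrightarrow> t \<le> 2 * pi \<longrightarrow>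
        norm (H t - H s) \<le> sqrt ((t - s) * sq_norm circle_measure (weak_deriv (X n))))" for n
    using W12_holder_representative[OF X[of n]] by metis
  then obtain H where eq: "\<And>n. AE x in circle_measure. X n x = H n x"
    and hoelder: "\<And>n s t. 0 \<le> s \<Longrightarrow> s \<le> t \<Longrightarrow> t \<le> 2 * pi \<Longrightarrow>
        norm (H n t - H n s) \<le> sqrt ((t - s) * sq_norm circle_measure (weak_deriv (X n)))"
    by metis
  have "0 \<le> B"
    using B(1)[of 0] sq_norm_nonneg order_trans by blast
  have hoelderB: "norm (H n t - H n s) \<le> sqrt (\<bar>t - s\<bar> * B)"
    if "s \<in> {0..2*pi}" "t \<in> {0..2*pi}" for n s t
  proof -
    have *: "norm (H n t - H n s) \<le> sqrt ((t - s) * B)" if "0 \<le> s" "s \<le> t" "t \<le> 2 * pi" for s t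
    proof -
      have "(t - s) * sq_norm circle_measure (weak_deriv (X n)) \<le> (t - s) * B"
        using B(2)[of n] that by (intro mult_left_mono) auto
      then show ?thesis
        using hoelder[OF that, of n] real_sqrt_le_mono order_trans by blast
    qed
    show ?thesis
    proof (cases "s \<le> t")
      case True
      then show ?thesis using *[of s t] that by simp
    next
      case False
      then show ?thesis using *[of t s] that by (simp add: norm_minus_commute)
    qed
  qed
  \<comment> \<open>The first root comes from the L2 bound, the second from the oscillation over the
    full length \<open>2 * pi\<close>.\<close>
  define M where "M = sqrt (2 * pi * B) + sqrt (2 * pi * B)"
  have HM: "norm (H n t) \<le> M" if "t \<in> {0..2*pi}" for n t
    unfolding M_def
  proof (rule circle_sup_bound[OF _ eq B(1) _ that])
    show "X n \<in> square_integrable circle_measure"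
      by (intro circle_L2_square_integrable W12_circle_L2 X)
    show "norm (H n t - H n s) \<le> sqrt (2 * pi * B)" if "s \<in> {0..2*pi}" "t \<in> {0..2*pi}" for s t
    proof -
      have "\<bar>t - s\<bar> * B \<le> 2 * pi * B"
        using that \<open>0 \<le> B\<close> by (intro mult_right_mono) auto
      then show ?thesis
        using hoelderB[OF that] real_sqrt_le_mono order_trans by blast
    qed
  qed
  have equicont: "\<exists>d. 0 < d \<and> (\<forall>n y. y \<in> {0..2*pi} \<and> norm (x - y) < d \<longrightarrow> norm (H n x - H n y) < e)"
    if x: "x \<in> {0..2*pi}" and e: "0 < e" for x e
  \<comment> \<open>At this distance \<open>sqrt (\<bar>x - y\<bar> * B)\<close> is below
    \<open>e\<close>; \<open>B + 1\<close> keeps the divisor positive when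
    \<open>B = 0\<close>.\<close>
  proof (intro exI[of _ "e\<^sup>2 / (B + 1)"] conjI allI impI)
    show "0 < e\<^sup>2 / (B + 1)"
      using \<open>0 \<le> B\<close> e by simp
    fix n y assume y: "y \<in> {0..2*pi} \<and> norm (x - y) < e\<^sup>2 / (B + 1)"
    have "norm (H n x - H n y) \<le> sqrt (\<bar>x - y\<bar> * B)"
      using hoelderB x y by blast
    also have "\<dots> < e"
    proof (rule real_less_lsqrt)
      have "\<bar>x - y\<bar> * B \<le> \<bar>x - y\<bar> * (B + 1)"
        by (intro mult_left_mono) auto
      also have "\<dots> < e\<^sup>2"
        using y \<open>0 \<le> B\<close> by (simp add: pos_less_divide_eq)
      finally show "\<bar>x - y\<bar> * B < e\<^sup>2" .
    qed (use e in simp)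
    finally show "norm (H n x - H n y) < e" .
  qed
  obtain G k where k: "strict_mono (k :: nat \<Rightarrow> nat)"
    and lim: "\<And>e. 0 < e \<Longrightarrow> \<exists>N. \<forall>n x. n \<ge> N \<and> x \<in> {0..2*pi} \<longrightarrow> norm (H (k n) x - G x) < e"
    using Arzela_Ascoli[OF compact_Icc HM equicont] by metis
  show ?thesis
  proof (rule that[OF k, of M G])
    have "AE x in circle_measure. norm (X n x) \<le> M" for n
      using eq[of n] AE_circle_measure_interior by eventually_elim (simp add: HM)
    then show "\<forall>n. AE x in circle_measure. norm (X n x) \<le> M"
      by blast
    show "\<forall>e>0. \<exists>N. \<forall>n\<ge>N. AE x in circle_measure. norm (X (k n) x - G x) \<le> e"
    proof (intro allI impI)
      fix e :: real assume "0 < e"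
      then obtain N where N: "\<And>n x. n \<ge> N \<Longrightarrow> x \<in> {0..2*pi} \<Longrightarrow> norm (H (k n) x - G x) < e"
        using lim by metis
      have "AE x in circle_measure. norm (X (k n) x - G x) \<le> e" if "n \<ge> N" for n
        using eq[of "k n"] AE_circle_measure_interior
      proof eventually_elim
        case (elim x)
        then show ?case
          using N[OF that, of x] by simp
      qed
      then show "\<exists>N. \<forall>n\<ge>N. AE x in circle_measure. norm (X (k n) x - G x) \<le> e"
        by blast
    qed
  qed
qed

section \<open>Determinants and jets\<close>

definition wedge :: "real^2 \<Rightarrow> real^2 \<Rightarrow> real" where
  "wedge a b = a $ 1 * b $ 2 - a $ 2 * b $ 1"

lemma wedge_simps:
  "wedge (a - a') b = wedge a b - wedge a' b"
  "wedge a (b + b') = wedge a b + wedge a b'" "wedge a (c *\<^sub>R b) = c * wedge a b"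
  by (simp_all add: wedge_def algebra_simps)

lemma abs_wedge_le: "\<bar>wedge a b\<bar> \<le> 2 * norm a * norm b"
proof -
  have "\<bar>a $ i * b $ j\<bar> \<le> norm a * norm b" for i j
    unfolding abs_mult by (intro mult_mono component_le_norm_cart) auto
  from this[of 1 2] this[of 2 1] show ?thesis
    unfolding wedge_def by linarith
qed

lemma continuous_on_wedge [continuous_intros]:
  "continuous_on S f \<Longrightarrow> continuous_on S g \<Longrightarrow> continuous_on S (\<lambda>x. wedge (f x) (g x))"
  unfolding wedge_def by (intro continuous_intros)

lemma tendsto_wedge [tendsto_intros]:
  "(f \<longlongrightarrow> a) F \<Longrightarrow> (g \<longlongrightarrow> b) F \<Longrightarrow> ((\<lambda>x. wedge (f x) (g x)) \<longlongrightarrow> wedge a b) F"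
  unfolding wedge_def by (intro tendsto_intros)

text \<open>The last component dominates the error made in passing from \<open>g\<close> to a uniform limit in the
  wedge product; carrying it along makes the error estimate pointwise and stable under midpoints.\<close>

definition jet :: "(real \<Rightarrow> real^2) \<Rightarrow> real \<Rightarrow> ((real^2) \<times> (real^2)) \<times> (real \<times> real)" where
  "jet g x = ((g x, weak_deriv g x), (wedge (g x) (weak_deriv g x), norm (weak_deriv g x)))"

lemma borel_measurable_jet:
  assumes "g \<in> circle_W12"
  shows "jet g \<in> borel_measurable circle_measure"
proof -
  have [measurable]: "g \<in> borel_measurable circle_measure" "weak_deriv g \<in> borel_measurable circle_measure"
    by (intro square_integrable_measurable circle_L2_square_integrable W12_circle_L2
        weak_deriv_W12 assms)+
  have "(\<lambda>x. wedge (g x) (weak_deriv g x)) \<in> borel_measurable circle_measure"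
    by (rule borel_measurable_continuous_Pair[where H = wedge])
      (measurable, intro continuous_on_wedge continuous_on_fst continuous_on_snd continuous_on_id)
  then show ?thesis
    unfolding jet_def by measurable
qed

text \<open>A product of two square-integrable functions is in general only integrable; the uniform
  bound on \<open>g\<close> is what puts the wedge component in L2. In the constant, the map, its
  derivative and the norm of the derivative count 1 each, the wedge product
  \<open>(2 * M)\<^sup>2\<close>.\<close>

lemma jet_square_integrable:
  assumes g: "g \<in> circle_W12" and M: "AE x in circle_measure. norm (g x) \<le> M"
    and B: "sq_norm circle_measure g \<le> B" "sq_norm circle_measure (weak_deriv g) \<le> B"
  shows "jet g \<in> square_integrable circle_measure"
    "sq_norm circle_measure (jet g) \<le> (3 + 4 * M\<^sup>2) * B"
proof -
  have int: "integrable circle_measure (\<lambda>x. (norm (g x))\<^sup>2)"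
    "integrable circle_measure (\<lambda>x. (norm (weak_deriv g x))\<^sup>2)"
    by (intro square_integrable_integrable circle_L2_square_integrable W12_circle_L2 weak_deriv_W12 g)+
  define u where "u = (\<lambda>x. (norm (g x))\<^sup>2 + (2 + 4 * M\<^sup>2) * (norm (weak_deriv g x))\<^sup>2)"
  have u: "integrable circle_measure u"
    unfolding u_def using int by simp
  have le: "AE x in circle_measure. (norm (jet g x))\<^sup>2 \<le> u x"
    using M
  proof eventually_elim
    case (elim x)
    have "\<bar>wedge (g x) (weak_deriv g x)\<bar> \<le> 2 * M * norm (weak_deriv g x)"
      by (rule order_trans[OF abs_wedge_le]) (intro mult_right_mono mult_left_mono elim, auto)
    then have "(wedge (g x) (weak_deriv g x))\<^sup>2 \<le> (2 * M * norm (weak_deriv g x))\<^sup>2"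
      by (intro abs_le_square_iff[THEN iffD1] order_trans[OF _ abs_ge_self])
    then show ?case
      by (simp add: jet_def norm_Pair u_def power_mult_distrib algebra_simps)
  qed
  have m: "(\<lambda>x. (norm (jet g x))\<^sup>2) \<in> borel_measurable circle_measure"
    using borel_measurable_jet[OF g] by simp
  have ij: "integrable circle_measure (\<lambda>x. (norm (jet g x))\<^sup>2)"
  proof (rule Bochner_Integration.integrable_bound[OF u m])
    show "AE x in circle_measure. norm ((norm (jet g x))\<^sup>2) \<le> norm (u x)"
      using le by eventually_elim simp
  qed
  then show "jet g \<in> square_integrable circle_measure"
    using borel_measurable_jet[OF g] by (simp add: square_integrable_def)
  have "sq_norm circle_measure (jet g) \<le> (\<integral>x. u x \<partial>circle_measure)"
    unfolding sq_norm_def by (rule integral_mono_AE[OF ij u le])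
  also have "\<dots> = sq_norm circle_measure g + (2 + 4 * M\<^sup>2) * sq_norm circle_measure (weak_deriv g)"
    unfolding u_def sq_norm_def using int by simp
  also have "\<dots> \<le> B + (2 + 4 * M\<^sup>2) * B"
    by (intro add_mono mult_left_mono B) simp
  finally show "sq_norm circle_measure (jet g) \<le> (3 + 4 * M\<^sup>2) * B"
    by (simp add: algebra_simps)
qed

text \<open>Differentiation and \<open>l\<close> are linear, so each of the claims is stable under
  midpoints. The wedge component is absent because in the hull it need not be that of the averaged
  map.\<close>

lemma midpoint_hull_jet:
  assumes X: "\<And>n. X n \<in> circle_W12" and l: "l \<in> W12_dual" and a: "\<And>n. m \<le> n \<Longrightarrow> a \<le> l (X n)"
    and f: "f \<in> midpoint_hull (\<lambda>n. jet (X n)) m"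
  shows "(\<lambda>x. fst (fst (f x))) \<in> circle_W12 \<and>
    (AE x in circle_measure. weak_deriv (\<lambda>x. fst (fst (f x))) x = snd (fst (f x))) \<and>
    a \<le> l (\<lambda>x. fst (fst (f x)))"
  using f
proof induction
  case (base n)
  then show ?case using X a by (simp add: jet_def)
next
  case (midpoint f g)
  define u v where "u = (\<lambda>x. fst (fst (f x)))" and "v = (\<lambda>x. fst (fst (g x)))"
  have u: "u \<in> circle_W12" "AE x in circle_measure. weak_deriv u x = snd (fst (f x))" "a \<le> l u"
    and v: "v \<in> circle_W12" "AE x in circle_measure. weak_deriv v x = snd (fst (g x))" "a \<le> l v"
    using midpoint(3,4) by (simp_all add: u_def v_def)
  have add: "\<And>f g. f \<in> circle_W12 \<Longrightarrow> g \<in> circle_W12 \<Longrightarrow> l (\<lambda>\<theta>. f \<theta> + g \<theta>) = l f + l g"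
    and scale: "\<And>c g. g \<in> circle_W12 \<Longrightarrow> l (\<lambda>\<theta>. c *\<^sub>R g \<theta>) = c * l g"
    using l by (simp_all add: W12_dual_def)
  have eq: "(\<lambda>x. fst (fst ((1/2) *\<^sub>R (f x + g x)))) = (\<lambda>x. (1/2) *\<^sub>R u x + (1/2) *\<^sub>R v x)"
    by (simp add: u_def v_def scaleR_add_right)
  have half: "(\<lambda>x. (1/2) *\<^sub>R u x) \<in> circle_W12" "(\<lambda>x. (1/2) *\<^sub>R v x) \<in> circle_W12"
    using W12_lincomb(1)[OF u(1) u(1), of "1/2" 0] W12_lincomb(1)[OF v(1) v(1), of "1/2" 0] by simp_all
  have "l (\<lambda>x. (1/2) *\<^sub>R u x + (1/2) *\<^sub>R v x) = (1/2) * l u + (1/2) * l v"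
    using add[OF half] scale[OF u(1)] scale[OF v(1)] by simp
  then have "a \<le> l (\<lambda>x. (1/2) *\<^sub>R u x + (1/2) *\<^sub>R v x)"
    using u(3) v(3) by simp
  moreover have "AE x in circle_measure. weak_deriv (\<lambda>x. (1/2) *\<^sub>R u x + (1/2) *\<^sub>R v x) x =
      snd (fst ((1/2) *\<^sub>R (f x + g x)))"
    using W12_lincomb(2)[OF u(1) v(1), of "1/2" "1/2"] u(2) v(2)
    by eventually_elim (simp add: scaleR_add_right)
  ultimately show ?case
    unfolding eq using W12_lincomb(1)[OF u(1) v(1)] by blast
qed

text \<open>With this functional and \<open>a = 0\<close>, \<open>midpoint_hull_jet\<close> yields
  its two claims about derivatives when no particular functional is at hand.\<close>

lemma zero_W12_dual: "(\<lambda>_. 0) \<in> W12_dual"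
  by (auto simp: W12_dual_def intro: exI[of _ 0])


text \<open>In the strong limit of hull elements, closedness of the derivative identifies the second
  component as the weak derivative of the first; the constraint \<open>Q\<close> identifies the
  first with \<open>G\<close> and the third with the wedge product. The fourth, a limit of averaged
  norms, stays an unspecified \<open>r\<close>: it can exceed \<open>norm (weak_deriv g x)\<close>,
  and only its finiteness matters.\<close>

theorem W12_midpoint_limit:
  assumes X: "\<And>n. X n \<in> circle_W12"
    and B: "\<And>n. sq_norm circle_measure (X n) \<le> B" "\<And>n. sq_norm circle_measure (weak_deriv (X n)) \<le> B"
    and M: "\<And>n. AE x in circle_measure. norm (X n x) \<le> M"
    and unif: "\<And>e. 0 < e \<Longrightarrow> \<exists>N. \<forall>n\<ge>N. AE x in circle_measure. norm (X n x - G x) \<le> e"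
  obtains g P where "g \<in> circle_W12" "AE x in circle_measure. g x = G x"
    "\<forall>m. P m \<in> midpoint_hull (\<lambda>n. jet (X n)) m"
    "AE x in circle_measure. \<exists>r. (\<lambda>m. P m x) \<longlonglongrightarrow>
      ((g x, weak_deriv g x), (wedge (g x) (weak_deriv g x), r))"
    "(\<lambda>m. sq_norm circle_measure (\<lambda>x. fst (fst (P m x)) - g x)) \<longlonglongrightarrow> 0"
    "(\<lambda>m. sq_norm circle_measure (\<lambda>x. snd (fst (P m x)) - weak_deriv g x)) \<longlonglongrightarrow> 0"
proof -
  let ?Y = "\<lambda>n. jet (X n)"
  have Y: "?Y n \<in> square_integrable circle_measure"
    "sq_norm circle_measure (?Y n) \<le> (3 + 4 * M\<^sup>2) * B" for n
    using jet_square_integrable[OF X M B] .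
  obtain P p where P: "\<And>m. P m \<in> midpoint_hull ?Y m" and p: "p \<in> square_integrable circle_measure"
    and lim: "AE x in circle_measure. (\<lambda>m. P m x) \<longlonglongrightarrow> p x"
    and L2lim: "(\<lambda>m. sq_norm circle_measure (\<lambda>x. P m x - p x)) \<longlonglongrightarrow> 0"
    by (rule midpoint_hull_converges[of ?Y, OF Y]) blast
  have P2: "P m \<in> square_integrable circle_measure" for m
    by (rule midpoint_hull_square_integrable[OF Y(1) P])
  define q where "q = (\<lambda>m x. fst (fst (P m x)))"
  have q: "q m \<in> circle_W12" "AE x in circle_measure. weak_deriv (q m) x = snd (fst (P m x))" for m
    unfolding q_def using midpoint_hull_jet[OF X zero_W12_dual order_refl P] by blast+
  \<comment> \<open>Projecting to a component does not increase the norm, so membership and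
    convergence in L2 pass to the components.\<close>
  have proj: "(\<lambda>x. \<pi> (f x)) \<in> square_integrable circle_measure"
      "sq_norm circle_measure (\<lambda>x. \<pi> (f x)) \<le> sq_norm circle_measure f"
    if \<pi>: "\<pi> \<in> borel_measurable borel" "\<And>z. norm (\<pi> z) \<le> norm z"
      and f: "f \<in> square_integrable circle_measure"
    for \<pi> :: "((real^2) \<times> (real^2)) \<times> (real \<times> real) \<Rightarrow> real^2" and f
  proof -
    have le: "(norm (\<pi> (f x)))\<^sup>2 \<le> (norm (f x))\<^sup>2" for x
      using \<pi>(2) by (intro power_mono) auto
    show *: "(\<lambda>x. \<pi> (f x)) \<in> square_integrable circle_measure"
      by (rule square_integrable_bound[OF measurable_compose[OF square_integrable_measurable[OF f] \<pi>(1)]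
            square_integrable_integrable[OF f] le])
    show "sq_norm circle_measure (\<lambda>x. \<pi> (f x)) \<le> sq_norm circle_measure f"
      unfolding sq_norm_def
      by (rule integral_mono[OF square_integrable_integrable[OF *] square_integrable_integrable[OF f] le])
  qed
  have fst_le: "norm (fst (fst z)) \<le> norm z" and snd_le: "norm (snd (fst z)) \<le> norm z"
    for z :: "((real^2) \<times> (real^2)) \<times> (real \<times> real)"
    by (metis norm_fst_le norm_snd_le order_trans prod.collapse)+
  have fst_m: "(\<lambda>z::((real^2) \<times> (real^2)) \<times> (real \<times> real). fst (fst z)) \<in> borel_measurable borel"
    and snd_m: "(\<lambda>z::((real^2) \<times> (real^2)) \<times> (real \<times> real). snd (fst z)) \<in> borel_measurable borel"
    by (intro borel_measurable_continuous_onI continuous_intros)+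
  note fst_proj = proj[OF fst_m fst_le] and snd_proj = proj[OF snd_m snd_le]
  have diff: "(\<lambda>x. P m x - p x) \<in> square_integrable circle_measure" for m
    by (rule square_integrable_diff[OF P2 p])
  have lim1: "(\<lambda>m. sq_norm circle_measure (\<lambda>x. q m x - fst (fst (p x)))) \<longlonglongrightarrow> 0"
  proof (rule tendsto_sandwich[OF _ _ tendsto_const L2lim])
    show "\<forall>\<^sub>F m in sequentially. sq_norm circle_measure (\<lambda>x. q m x - fst (fst (p x))) \<le>
        sq_norm circle_measure (\<lambda>x. P m x - p x)"
      using fst_proj(2)[OF diff] by (simp add: q_def)
  qed (simp add: sq_norm_nonneg)
  have lim2: "(\<lambda>m. sq_norm circle_measure (\<lambda>x. snd (fst (P m x)) - snd (fst (p x)))) \<longlonglongrightarrow> 0"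
  proof (rule tendsto_sandwich[OF _ _ tendsto_const L2lim])
    show "\<forall>\<^sub>F m in sequentially. sq_norm circle_measure (\<lambda>x. snd (fst (P m x)) - snd (fst (p x))) \<le>
        sq_norm circle_measure (\<lambda>x. P m x - p x)"
      using snd_proj(2)[OF diff] by simp
  qed (simp add: sq_norm_nonneg)
  have qm: "weak_deriv (q m) \<in> borel_measurable circle_measure" for m
    by (intro square_integrable_measurable circle_L2_square_integrable weak_deriv_W12 q)
  have pm: "(\<lambda>x. snd (fst (p x))) \<in> borel_measurable circle_measure"
    "(\<lambda>x. snd (fst (P m x))) \<in> borel_measurable circle_measure" for m
    by (rule square_integrable_measurable[OF snd_proj(1)[OF p]]
        square_integrable_measurable[OF snd_proj(1)[OF P2]])+
  have "sq_norm circle_measure (\<lambda>x. weak_deriv (q m) x - snd (fst (p x))) =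
      sq_norm circle_measure (\<lambda>x. snd (fst (P m x)) - snd (fst (p x)))" for m
  proof (rule sq_norm_cong_AE)
    show "AE x in circle_measure. weak_deriv (q m) x - snd (fst (p x)) = snd (fst (P m x)) - snd (fst (p x))"
      using q(2)[of m] by eventually_elim simp
  qed (intro borel_measurable_diff qm pm)+
  then have "(\<lambda>m. sq_norm circle_measure (\<lambda>x. weak_deriv (q m) x - snd (fst (p x)))) \<longlonglongrightarrow> 0"
    using lim2 by simp
  then obtain g where g: "g \<in> circle_W12" "AE x in circle_measure. g x = fst (fst (p x))"
    "AE x in circle_measure. weak_deriv g x = snd (fst (p x))"
    by (rule circle_W12_closed[OF q(1) fst_proj(1)[OF p] snd_proj(1)[OF p] lim1]) blast
  have "\<exists>N. \<forall>n\<ge>N. AE x in circle_measure. norm (X n x - G x) \<le> inverse (real (Suc j))" for j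
    by (rule unif) simp
  then obtain N where N: "\<And>j n. n \<ge> N j \<Longrightarrow> AE x in circle_measure. norm (X n x - G x) \<le> inverse (real (Suc j))"
    by metis
  \<comment> \<open>Each condition bounds the norm of an affine function of \<open>z\<close> by an
    affine function of \<open>z\<close>, hence is stable under midpoints; the factor 2 is that of
    \<open>abs_wedge_le\<close>.\<close>
  define Q where "Q = (\<lambda>j x (z :: ((real^2) \<times> (real^2)) \<times> (real \<times> real)).
    norm (fst (fst z) - G x) \<le> inverse (real (Suc j)) \<and>
    \<bar>fst (snd z) - wedge (G x) (snd (fst z))\<bar> \<le> 2 * inverse (real (Suc j)) * snd (snd z))"
  have "AE x in circle_measure. Q j x (P m x)" if "N j \<le> m" for j m
  proof (rule midpoint_hull_AE[OF P])
    fix n assume "m \<le> n"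
    then have "AE x in circle_measure. norm (X n x - G x) \<le> inverse (real (Suc j))"
      using that by (intro N) simp
    then show "AE x in circle_measure. Q j x (jet (X n) x)"
    proof eventually_elim
      case (elim x)
      have "\<bar>wedge (X n x - G x) (weak_deriv (X n) x)\<bar> \<le> 2 * inverse (real (Suc j)) * norm (weak_deriv (X n) x)"
        by (rule order_trans[OF abs_wedge_le]) (intro mult_right_mono mult_left_mono elim, auto)
      then show ?case
        using elim by (simp add: Q_def jet_def wedge_simps)
    qed
  next
    fix x a b assume ab: "Q j x a" "Q j x b"
    define e where "e = inverse (real (Suc j))"
    have "norm ((1/2) *\<^sub>R ((fst (fst a) - G x) + (fst (fst b) - G x))) \<le> e"
      using ab norm_triangle_ineq[of "fst (fst a) - G x" "fst (fst b) - G x"] by (simp add: Q_def e_def)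
    moreover have "(1/2) *\<^sub>R ((fst (fst a) - G x) + (fst (fst b) - G x)) = fst (fst ((1/2) *\<^sub>R (a + b))) - G x"
      using scaleR_half_double[of "G x"] by (simp add: algebra_simps)
    ultimately have 1: "norm (fst (fst ((1/2) *\<^sub>R (a + b))) - G x) \<le> e"
      by metis
    define A B where "A = fst (snd a) - wedge (G x) (snd (fst a))"
      and "B = fst (snd b) - wedge (G x) (snd (fst b))"
    have "\<bar>A\<bar> \<le> 2 * e * snd (snd a)" "\<bar>B\<bar> \<le> 2 * e * snd (snd b)"
      using ab by (simp_all add: Q_def A_def B_def e_def)
    then have "\<bar>(A + B) / 2\<bar> \<le> (2 * e * snd (snd a) + 2 * e * snd (snd b)) / 2"
      using abs_triangle_ineq[of A B] by simp
    moreover have "fst (snd ((1/2) *\<^sub>R (a + b))) - wedge (G x) (snd (fst ((1/2) *\<^sub>R (a + b)))) = (A + B) / 2"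
      by (simp add: A_def B_def wedge_simps field_simps)
    moreover have "2 * e * snd (snd ((1/2) *\<^sub>R (a + b))) = (2 * e * snd (snd a) + 2 * e * snd (snd b)) / 2"
      by (simp add: algebra_simps)
    ultimately show "Q j x ((1/2) *\<^sub>R (a + b))"
      unfolding Q_def e_def[symmetric] using 1 by (simp only:)
  qed
  \<comment> \<open>Countably many exceptional sets are united, so that at a fixed point
    \<open>m\<close> and afterwards \<open>j\<close> may tend to infinity.\<close>
  then have "AE x in circle_measure. \<forall>j m. N j \<le> m \<longrightarrow> Q j x (P m x)"
    by (simp add: AE_all_countable)
  then have key: "AE x in circle_measure. fst (fst (p x)) = G x \<and> fst (snd (p x)) = wedge (G x) (snd (fst (p x)))"
    using lim
  proof eventually_elim
    case (elim x)
    have inv0: "(\<lambda>j. c * inverse (real (Suc j))) \<longlonglongrightarrow> 0" for c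
      using tendsto_mult_left[OF LIMSEQ_inverse_real_of_nat, of c] by simp
    have "norm (fst (fst (p x)) - G x) \<le> inverse (real (Suc j))" for j
    proof (rule LIMSEQ_le_const2)
      show "(\<lambda>m. norm (fst (fst (P m x)) - G x)) \<longlonglongrightarrow> norm (fst (fst (p x)) - G x)"
        by (intro tendsto_intros elim(2))
      show "\<exists>N. \<forall>m\<ge>N. norm (fst (fst (P m x)) - G x) \<le> inverse (real (Suc j))"
        using elim(1) by (auto simp: Q_def)
    qed
    then have "norm (fst (fst (p x)) - G x) \<le> 0"
      by (intro LIMSEQ_le_const[OF inv0[of 1]]) auto
    moreover have "\<bar>fst (snd (p x)) - wedge (G x) (snd (fst (p x)))\<bar> \<le> 2 * snd (snd (p x)) * inverse (real (Suc j))" for j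
    proof (rule LIMSEQ_le)
      show "(\<lambda>m. \<bar>fst (snd (P m x)) - wedge (G x) (snd (fst (P m x)))\<bar>) \<longlonglongrightarrow>
          \<bar>fst (snd (p x)) - wedge (G x) (snd (fst (p x)))\<bar>"
        by (intro tendsto_intros elim(2))
      show "(\<lambda>m. 2 * snd (snd (P m x)) * inverse (real (Suc j))) \<longlonglongrightarrow> 2 * snd (snd (p x)) * inverse (real (Suc j))"
        by (intro tendsto_mult tendsto_const tendsto_snd elim(2))
      show "\<exists>N. \<forall>m\<ge>N. \<bar>fst (snd (P m x)) - wedge (G x) (snd (fst (P m x)))\<bar> \<le>
          2 * snd (snd (P m x)) * inverse (real (Suc j))"
        using elim(1) by (auto simp: Q_def mult.commute mult.left_commute)
    qed
    \<comment> \<open>\<open>snd (snd (p x))\<close> is a fixed finite number, so the factor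
      \<open>inverse (real (Suc j))\<close> drives the bound to 0.\<close>
    then have "\<bar>fst (snd (p x)) - wedge (G x) (snd (fst (p x)))\<bar> \<le> 0"
      by (intro LIMSEQ_le_const[OF inv0[of "2 * snd (snd (p x))"]]) auto
    ultimately show ?case by simp
  qed
  show ?thesis
  proof (rule that[of g P])
    show "AE x in circle_measure. g x = G x"
      using key g(2) by eventually_elim simp
    show "AE x in circle_measure. \<exists>r. (\<lambda>m. P m x) \<longlonglongrightarrow> ((g x, weak_deriv g x), (wedge (g x) (weak_deriv g x), r))"
      using key g(2,3) lim
    proof eventually_elim
      case (elim x)
      then have "p x = ((g x, weak_deriv g x), (wedge (g x) (weak_deriv g x), snd (snd (p x))))"
        by (auto simp: prod_eq_iff)
      then show ?case
        using elim(4) by metis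
    qed
    have gm: "g \<in> borel_measurable circle_measure" "weak_deriv g \<in> borel_measurable circle_measure"
      by (intro square_integrable_measurable circle_L2_square_integrable W12_circle_L2 weak_deriv_W12 g)+
    have qm': "q m \<in> borel_measurable circle_measure" for m
      by (intro square_integrable_measurable circle_L2_square_integrable W12_circle_L2 q)
    have "sq_norm circle_measure (\<lambda>x. fst (fst (P m x)) - g x) = sq_norm circle_measure (\<lambda>x. q m x - fst (fst (p x)))" for m
    proof (rule sq_norm_cong_AE)
      show "AE x in circle_measure. fst (fst (P m x)) - g x = q m x - fst (fst (p x))"
        using g(2) by eventually_elim (simp add: q_def)
      show "(\<lambda>x. fst (fst (P m x)) - g x) \<in> borel_measurable circle_measure"
        using borel_measurable_diff[OF qm'[of m] gm(1)] by (simp add: q_def)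
      show "(\<lambda>x. q m x - fst (fst (p x))) \<in> borel_measurable circle_measure"
        by (rule borel_measurable_diff[OF qm' square_integrable_measurable[OF fst_proj(1)[OF p]]])
    qed
    then show "(\<lambda>m. sq_norm circle_measure (\<lambda>x. fst (fst (P m x)) - g x)) \<longlonglongrightarrow> 0"
      using lim1 by simp
    have "sq_norm circle_measure (\<lambda>x. snd (fst (P m x)) - weak_deriv g x) =
        sq_norm circle_measure (\<lambda>x. snd (fst (P m x)) - snd (fst (p x)))" for m
    proof (rule sq_norm_cong_AE)
      show "AE x in circle_measure. snd (fst (P m x)) - weak_deriv g x = snd (fst (P m x)) - snd (fst (p x))"
        using g(3) by eventually_elim simp
    qed (intro borel_measurable_diff pm gm)+
    then show "(\<lambda>m. sq_norm circle_measure (\<lambda>x. snd (fst (P m x)) - weak_deriv g x)) \<longlonglongrightarrow> 0"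
      using lim2 by simp
  qed (use P g in auto)
qed

text \<open>A half-space is stable under midpoints: if \<open>l\<close> stayed above
  \<open>l g + e\<close> along a subsequence, it would do so on the hull of that subsequence, whose
  elements approach a representative of \<open>g\<close> strongly. Applying this to \<open>l\<close>
  and to its negative gives both sides of the limit.\<close>

theorem W12_weakly_converges_of_uniform:
  assumes X: "\<And>n. X n \<in> circle_W12"
    and B: "\<And>n. sq_norm circle_measure (X n) \<le> B" "\<And>n. sq_norm circle_measure (weak_deriv (X n)) \<le> B"
    and M: "\<And>n. AE x in circle_measure. norm (X n x) \<le> M"
    and unif: "\<And>e. 0 < e \<Longrightarrow> \<exists>N. \<forall>n\<ge>N. AE x in circle_measure. norm (X n x - G x) \<le> e"
    and g: "g \<in> circle_W12" "AE x in circle_measure. g x = G x"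
  shows "W12_weakly_converges X g"
proof -
  have upper: "\<forall>\<^sub>F n in sequentially. l (X n) < l g + e" if l: "l \<in> W12_dual" and e: "0 < e" for l e
  proof (rule ccontr)
    assume "\<not> (\<forall>\<^sub>F n in sequentially. l (X n) < l g + e)"
    then obtain r where r: "strict_mono (r :: nat \<Rightarrow> nat)" and ge: "\<And>n. l g + e \<le> l (X (r n))"
      by (auto dest!: not_eventually_sequentiallyD simp: not_less)
    have unif': "\<exists>N. \<forall>n\<ge>N. AE x in circle_measure. norm (X (r n) x - G x) \<le> d" if "0 < d" for d
    proof -
      obtain N where "\<And>n. n \<ge> N \<Longrightarrow> AE x in circle_measure. norm (X n x - G x) \<le> d"
        using unif[OF \<open>0 < d\<close>] by blast
      then show ?thesis
        using strict_mono_imp_increasing[OF r] order_trans by blast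
    qed
    obtain u P where u: "u \<in> circle_W12" "AE x in circle_measure. u x = G x"
      and "\<forall>m. P m \<in> midpoint_hull (\<lambda>n. jet (X (r n))) m"
      and "AE x in circle_measure. \<exists>r. (\<lambda>m. P m x) \<longlonglongrightarrow>
        ((u x, weak_deriv u x), (wedge (u x) (weak_deriv u x), r))"
      and lim: "(\<lambda>m. sq_norm circle_measure (\<lambda>x. fst (fst (P m x)) - u x)) \<longlonglongrightarrow> 0"
        "(\<lambda>m. sq_norm circle_measure (\<lambda>x. snd (fst (P m x)) - weak_deriv u x)) \<longlonglongrightarrow> 0"
      by (rule W12_midpoint_limit[of "\<lambda>n. X (r n)", OF X B M]) (erule unif', rule that)
    then have P: "P m \<in> midpoint_hull (\<lambda>n. jet (X (r n))) m" for m
      by blast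
    obtain K where K: "\<And>f g. f \<in> circle_W12 \<Longrightarrow> g \<in> circle_W12 \<Longrightarrow> \<bar>l f - l g\<bar> \<le>
        K * sqrt (sq_norm circle_measure (\<lambda>x. f x - g x) +
          sq_norm circle_measure (\<lambda>x. weak_deriv f x - weak_deriv g x))"
      using W12_dual_diff_le[OF l] by blast
    define q where "q = (\<lambda>m x. fst (fst (P m x)))"
    have q: "q m \<in> circle_W12" "AE x in circle_measure. weak_deriv (q m) x = snd (fst (P m x))"
      "l g + e \<le> l (q m)" for m
      unfolding q_def using midpoint_hull_jet[OF X l ge P] by blast+
    have meas: "weak_deriv f \<in> borel_measurable circle_measure" "f \<in> borel_measurable circle_measure"
      if "f \<in> circle_W12" for f
      by (intro square_integrable_measurable circle_L2_square_integrable W12_circle_L2 weak_deriv_W12 that)+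
    \<comment> \<open>\<open>u\<close> and \<open>g\<close> may be different representatives of one
      class; the norm bound forces \<open>l\<close> to agree on them.\<close>
    have eq: "AE x in circle_measure. u x = g x"
      using u(2) g(2) by eventually_elim simp
    have "sq_norm circle_measure (\<lambda>x. u x - g x) = 0"
      unfolding sq_norm_def by (rule integral_eq_zero_AE) (use eq in eventually_elim, simp)
    moreover have "sq_norm circle_measure (\<lambda>x. weak_deriv u x - weak_deriv g x) = 0"
      unfolding sq_norm_def
      by (rule integral_eq_zero_AE) (use weak_deriv_cong_AE[OF u(1) g(1) eq] in eventually_elim, simp)
    ultimately have "l u = l g"
      using K[OF u(1) g(1)] by simp
    have "sq_norm circle_measure (\<lambda>x. weak_deriv (q m) x - weak_deriv u x) =
        sq_norm circle_measure (\<lambda>x. snd (fst (P m x)) - weak_deriv u x)" for m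
    proof (rule sq_norm_cong_AE)
      show "AE x in circle_measure. weak_deriv (q m) x - weak_deriv u x = snd (fst (P m x)) - weak_deriv u x"
        using q(2)[of m] by eventually_elim simp
      have "P m \<in> borel_measurable circle_measure"
        by (intro square_integrable_measurable
            midpoint_hull_square_integrable[OF jet_square_integrable(1)[OF X M B] P])
      moreover have "(\<lambda>z::((real^2) \<times> (real^2)) \<times> (real \<times> real). snd (fst z)) \<in> borel_measurable borel"
        by (intro borel_measurable_continuous_onI continuous_intros)
      ultimately have "(\<lambda>x. snd (fst (P m x))) \<in> borel_measurable circle_measure"
        by (rule measurable_compose)
      then show "(\<lambda>x. snd (fst (P m x)) - weak_deriv u x) \<in> borel_measurable circle_measure"
        by (rule borel_measurable_diff[OF _ meas(1)[OF u(1)]])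
    qed (intro borel_measurable_diff meas q u)
    then have "(\<lambda>m. K * sqrt (sq_norm circle_measure (\<lambda>x. q m x - u x) +
        sq_norm circle_measure (\<lambda>x. weak_deriv (q m) x - weak_deriv u x))) \<longlonglongrightarrow> 0"
      using tendsto_mult_left[OF tendsto_real_sqrt[OF tendsto_add[OF lim]], of K] by (simp add: q_def)
    moreover have "e \<le> K * sqrt (sq_norm circle_measure (\<lambda>x. q m x - u x) +
        sq_norm circle_measure (\<lambda>x. weak_deriv (q m) x - weak_deriv u x))" for m
      using K[OF q(1) u(1), of m] q(3)[of m] \<open>l u = l g\<close> by linarith
    ultimately have "e \<le> 0"
      by (intro LIMSEQ_le_const) auto
    then show False using e by simp
  qed
  show ?thesis
    unfolding W12_weakly_converges_def
  proof (intro ballI order_tendstoI)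
    fix l a assume l: "l \<in> W12_dual"
    show "\<forall>\<^sub>F n in sequentially. l (X n) < a" if "l g < a"
      using upper[OF l, of "a - l g"] that by simp
    have "(\<lambda>f. - l f) \<in> W12_dual"
      using l by (auto simp: W12_dual_def)
    then show "\<forall>\<^sub>F n in sequentially. a < l (X n)" if "a < l g"
      using upper[of "\<lambda>f. - l f" "l g - a"] that by simp
  qed
qed

section \<open>The energy\<close>

text \<open>The matrix is the one with columns \<open>a\<close> and \<open>b\<close>, multiplied by
  the rotation with rows \<open>e_R \<theta>\<close> and \<open>e_theta \<theta>\<close>; neither
  the Frobenius norm nor the determinant changes under it.\<close>

lemma norm_tensor_frame:
  "(norm (tensor a (e_R \<theta>) + tensor b (e_theta \<theta>)))\<^sup>2 = (norm a)\<^sup>2 + (norm b)\<^sup>2"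
proof -
  have "cos \<theta> * cos \<theta> + sin \<theta> * sin \<theta> = 1"
    using sin_cos_squared_add3 by blast
  then have "(a $ i * cos \<theta> - b $ i * sin \<theta>)\<^sup>2 + (a $ i * sin \<theta> + b $ i * cos \<theta>)\<^sup>2 = (a $ i)\<^sup>2 + (b $ i)\<^sup>2" for i
    by algebra
  from this[of 1] this[of 2] show ?thesis
    unfolding power2_norm_eq_inner inner_vec_def sum_2
    by (simp add: tensor_def e_R_def e_theta_def power2_eq_square)
qed

lemma det_tensor_frame:
  "det (tensor a (e_R \<theta>) + tensor b (e_theta \<theta>)) = wedge a b"
proof -
  have "cos \<theta> * cos \<theta> + sin \<theta> * sin \<theta> = 1"
    using sin_cos_squared_add3 by blast
  then have "(a $ 1 * cos \<theta> - b $ 1 * sin \<theta>) * (a $ 2 * sin \<theta> + b $ 2 * cos \<theta>) -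
      (a $ 1 * sin \<theta> + b $ 1 * cos \<theta>) * (a $ 2 * cos \<theta> - b $ 2 * sin \<theta>) = a $ 1 * b $ 2 - a $ 2 * b $ 1"
    by algebra
  then show ?thesis
    by (simp add: det_2 tensor_def e_R_def e_theta_def wedge_def)
qed

definition jet_energy :: "(real \<Rightarrow> ennreal) \<Rightarrow> ((real^2) \<times> (real^2)) \<times> (real \<times> real) \<Rightarrow> ennreal" where
  "jet_energy h z = ennreal (((norm (fst (fst z)))\<^sup>2 + (norm (snd (fst z)))\<^sup>2) / 2) + h (fst (snd z))"

lemma circle_energy_jet:
  "circle_energy h g = (\<integral>\<^sup>+x. jet_energy h (jet g x) \<partial>circle_measure)"
proof -
  have "stored_energy h (grad_one_hom g x) = jet_energy h (jet g x)" for x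
    by (simp only: stored_energy_def grad_one_hom_def norm_tensor_frame det_tensor_frame
        jet_energy_def jet_def fst_conv snd_conv)
  then show ?thesis
    unfolding circle_energy_def circle_measure_def by (subst nn_integral_restrict_space) simp_all
qed

section \<open>Continuity and convexity of the energy density\<close>

lemma det_energy_real:
  assumes "det_energy h" "0 < t"
  shows "h t = ennreal (enn2real (h t))"
  using assms by (simp add: det_energy_def)

text \<open>At 0 the blow-up from the right meets the constant value infinity on the left.
  Continuity in \<open>ennreal\<close> therefore makes no exception for points where the limiting
  determinant vanishes.\<close>

lemma det_energy_isCont:
  assumes h: "det_energy h"
  shows "isCont h t"
proof -
  have nonpos: "h s = \<infinity>" if "s \<le> 0" for s
    using h that by (simp add: det_energy_def)
  consider "t < 0" | "t = 0" | "0 < t"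
    by linarith
  then show ?thesis
  proof cases
    case 1
    have "\<forall>\<^sub>F s in at t. h s = \<infinity>"
      using eventually_at_in_open'[of "{..<0}" t] 1 nonpos
      by (auto elim!: eventually_mono simp del: infinity_ennreal_def)
    then show ?thesis
      using nonpos[of t] 1 by (simp add: isCont_def tendsto_eventually)
  next
    case 2
    have "\<forall>\<^sub>F s in at_left 0. h s = \<infinity>"
      unfolding eventually_at_filter using nonpos by (simp del: infinity_ennreal_def)
    then have "(h \<longlongrightarrow> \<infinity>) (at_left 0)"
      by (rule tendsto_eventually)
    moreover have "(h \<longlongrightarrow> \<infinity>) (at_right 0)"
      using h by (simp add: det_energy_def)
    ultimately show ?thesis
      using nonpos[of 0] by (simp add: isCont_def 2 filterlim_at_split)
  next
    case 3
    obtain h' where "((\<lambda>s. enn2real (h s)) has_real_derivative h' t) (at t)"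
      using h 3 by (auto simp: det_energy_def)
    then have "((\<lambda>s. enn2real (h s)) \<longlongrightarrow> enn2real (h t)) (at t)"
      using DERIV_isCont isCont_def by blast
    then have "((\<lambda>s. ennreal (enn2real (h s))) \<longlongrightarrow> ennreal (enn2real (h t))) (at t)"
      by (rule tendsto_ennrealI)
    moreover have "\<forall>\<^sub>F s in at t. ennreal (enn2real (h s)) = h s"
      using eventually_at_in_open'[of "{0<..}" t] 3
      by (auto elim!: eventually_mono simp flip: det_energy_real[OF h])
    ultimately show ?thesis
      unfolding isCont_def using det_energy_real[OF h 3] by (metis tendsto_cong)
  qed
qed

text \<open>A nonpositive argument makes the right-hand side infinite; for positive arguments the
  lower bound on the second derivative gives convexity. The factor 2 stands on the left to avoid
  division in \<open>ennreal\<close>.\<close>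

lemma det_energy_midpoint:
  assumes h: "det_energy h"
  shows "2 * h ((s + t) / 2) \<le> h s + h t"
proof (cases "0 < s \<and> 0 < t")
  case False
  then have "h s + h t = \<infinity>"
    using h by (auto simp: det_energy_def not_less)
  then show ?thesis
    by (simp only:) simp
next
  case True
  obtain h' h'' \<mu> where "0 < \<mu>"
    and d: "\<forall>t>0. ((\<lambda>s. enn2real (h s)) has_real_derivative h' t) (at t)"
      "\<forall>t>0. (h' has_real_derivative h'' t) (at t)" "\<forall>t>0. \<mu> \<le> h'' t"
    using h unfolding det_energy_def by blast
  have "convex_on {0<..} (\<lambda>s. enn2real (h s))"
  proof (rule f''_ge0_imp_convex)
    show "0 \<le> h'' x" if "x \<in> {0<..}" for x
      using d(3) \<open>0 < \<mu>\<close> that less_imp_le order_trans by (metis greaterThan_iff)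
  qed (use d in auto)
  from convex_onD[OF this, of "1/2" s t] True
  have "enn2real (h ((s + t) / 2)) \<le> enn2real (h s) / 2 + enn2real (h t) / 2"
    by (simp add: field_simps)
  then have "2 * enn2real (h ((s + t) / 2)) \<le> enn2real (h s) + enn2real (h t)"
    by simp
  then have "ennreal (2 * enn2real (h ((s + t) / 2))) \<le> ennreal (enn2real (h s) + enn2real (h t))"
    by (rule ennreal_leI)
  then have "2 * ennreal (enn2real (h ((s + t) / 2))) \<le> ennreal (enn2real (h s)) + ennreal (enn2real (h t))"
    by (simp add: ennreal_mult)
  then show ?thesis
    using True by (simp flip: det_energy_real[OF h])
qed

lemma jet_energy_midpoint:
  assumes h: "det_energy h"
  shows "2 * jet_energy h ((1/2) *\<^sub>R (y + z)) \<le> jet_energy h y + jet_energy h z"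
proof -
  have sq: "2 * (norm ((1/2) *\<^sub>R (a + b)))\<^sup>2 \<le> (norm a)\<^sup>2 + (norm b)\<^sup>2" for a b :: "real^2"
    using norm_add_sq_le[of a b] by (simp add: power_divide)
  have "2 * (((norm (fst (fst ((1/2) *\<^sub>R (y + z)))))\<^sup>2 + (norm (snd (fst ((1/2) *\<^sub>R (y + z)))))\<^sup>2) / 2) \<le>
      ((norm (fst (fst y)))\<^sup>2 + (norm (snd (fst y)))\<^sup>2) / 2 + ((norm (fst (fst z)))\<^sup>2 + (norm (snd (fst z)))\<^sup>2) / 2"
    using sq[of "fst (fst y)" "fst (fst z)"] sq[of "snd (fst y)" "snd (fst z)"]
    unfolding fst_scaleR snd_scaleR fst_add snd_add by argo
  from ennreal_leI[OF this]
  have "2 * ennreal (((norm (fst (fst ((1/2) *\<^sub>R (y + z)))))\<^sup>2 + (norm (snd (fst ((1/2) *\<^sub>R (y + z)))))\<^sup>2) / 2) \<le>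
      ennreal (((norm (fst (fst y)))\<^sup>2 + (norm (snd (fst y)))\<^sup>2) / 2) +
      ennreal (((norm (fst (fst z)))\<^sup>2 + (norm (snd (fst z)))\<^sup>2) / 2)"
    by (subst (asm) ennreal_mult, simp, simp, subst (asm) ennreal_plus, simp, simp) simp
  moreover have "2 * h (fst (snd ((1/2) *\<^sub>R (y + z)))) \<le> h (fst (snd y)) + h (fst (snd z))"
    using det_energy_midpoint[OF h, of "fst (snd y)" "fst (snd z)"] by simp
  ultimately have "2 * ennreal (((norm (fst (fst ((1/2) *\<^sub>R (y + z)))))\<^sup>2 + (norm (snd (fst ((1/2) *\<^sub>R (y + z)))))\<^sup>2) / 2) +
      2 * h (fst (snd ((1/2) *\<^sub>R (y + z)))) \<le>
      (ennreal (((norm (fst (fst y)))\<^sup>2 + (norm (snd (fst y)))\<^sup>2) / 2) +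
      ennreal (((norm (fst (fst z)))\<^sup>2 + (norm (snd (fst z)))\<^sup>2) / 2)) + (h (fst (snd y)) + h (fst (snd z)))"
    by (rule add_mono)
  then show ?thesis
    unfolding jet_energy_def distrib_left by (simp only: add_ac)
qed

lemma tendsto_jet_energy:
  assumes h: "det_energy h" and f: "(f \<longlongrightarrow> z) F"
  shows "((\<lambda>x. jet_energy h (f x)) \<longlongrightarrow> jet_energy h z) F"
proof -
  have 1: "((\<lambda>x. ((norm (fst (fst (f x))))\<^sup>2 + (norm (snd (fst (f x))))\<^sup>2) / 2) \<longlongrightarrow>
      ((norm (fst (fst z)))\<^sup>2 + (norm (snd (fst z)))\<^sup>2) / 2) F"
    by (rule tendsto_divide[OF tendsto_add[OF tendsto_power[OF tendsto_norm[OF tendsto_fst[OF tendsto_fst[OF f]]]]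
            tendsto_power[OF tendsto_norm[OF tendsto_snd[OF tendsto_fst[OF f]]]]] tendsto_const]) simp
  have 2: "((\<lambda>x. h (fst (snd (f x)))) \<longlongrightarrow> h (fst (snd z))) F"
    by (rule isCont_tendsto_compose[OF det_energy_isCont[OF h] tendsto_fst[OF tendsto_snd[OF f]]])
  show ?thesis
    unfolding jet_energy_def by (rule tendsto_add[OF tendsto_ennrealI[OF 1] 2])
qed

lemma borel_measurable_jet_energy:
  assumes h: "det_energy h" and f: "f \<in> borel_measurable M"
  shows "(\<lambda>x. jet_energy h (f x)) \<in> borel_measurable M"
proof -
  have "isCont (jet_energy h) z" for z
    unfolding isCont_def by (rule tendsto_jet_energy[OF h]) (rule tendsto_ident_at)
  then have "continuous_on UNIV (jet_energy h)"
    by (intro continuous_at_imp_continuous_on ballI)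
  then have "jet_energy h \<in> borel_measurable borel"
    by (rule borel_measurable_continuous_onI)
  then show ?thesis
    by (rule measurable_compose[OF f])
qed

text \<open>Sublevel sets of a convex energy are stable under midpoints. Measurability is carried
  through the induction because additivity of the integral needs it.\<close>

lemma midpoint_hull_jet_energy_le:
  assumes h: "det_energy h" and Y: "\<And>n. Y n \<in> borel_measurable M"
    and c: "\<And>n. m \<le> n \<Longrightarrow> (\<integral>\<^sup>+x. jet_energy h (Y n x) \<partial>M) \<le> c"
    and f: "f \<in> midpoint_hull Y m"
  shows "f \<in> borel_measurable M \<and> (\<integral>\<^sup>+x. jet_energy h (f x) \<partial>M) \<le> c"
  using f
proof induction
  case (base n)
  then show ?case using Y c by simp
next
  case (midpoint f g)
  then have fg: "f \<in> borel_measurable M" "g \<in> borel_measurable M"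
    "(\<integral>\<^sup>+x. jet_energy h (f x) \<partial>M) \<le> c" "(\<integral>\<^sup>+x. jet_energy h (g x) \<partial>M) \<le> c"
    by simp_all
  have m: "(\<lambda>x. (1/2) *\<^sub>R (f x + g x)) \<in> borel_measurable M"
    using fg by (intro borel_measurable_scaleR borel_measurable_const borel_measurable_add)
  have "2 * (\<integral>\<^sup>+x. jet_energy h ((1/2) *\<^sub>R (f x + g x)) \<partial>M) =
      (\<integral>\<^sup>+x. 2 * jet_energy h ((1/2) *\<^sub>R (f x + g x)) \<partial>M)"
    by (rule nn_integral_cmult[symmetric]) (rule borel_measurable_jet_energy[OF h m])
  also have "\<dots> \<le> (\<integral>\<^sup>+x. jet_energy h (f x) + jet_energy h (g x) \<partial>M)"
    by (intro nn_integral_mono jet_energy_midpoint h)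
  also have "\<dots> = (\<integral>\<^sup>+x. jet_energy h (f x) \<partial>M) + (\<integral>\<^sup>+x. jet_energy h (g x) \<partial>M)"
    by (intro nn_integral_add borel_measurable_jet_energy h fg)
  also have "\<dots> \<le> 2 * c"
    using add_mono[OF fg(3,4)] by (simp add: mult_2)
  finally have "(\<integral>\<^sup>+x. jet_energy h ((1/2) *\<^sub>R (f x + g x)) \<partial>M) \<le> c"
    by (subst (asm) ennreal_mult_le_mult_iff) auto
  then show ?case using m by simp
qed

section \<open>Coercivity and the direct method\<close>

lemma circle_energy_coercive:
  assumes g: "g \<in> circle_W12" and c: "circle_energy h g \<le> ennreal c" "0 \<le> c"
  shows "sq_norm circle_measure g \<le> 2 * c" "sq_norm circle_measure (weak_deriv g) \<le> 2 * c"
proof -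
  have int: "integrable circle_measure (\<lambda>x. (norm (g x))\<^sup>2)"
    "integrable circle_measure (\<lambda>x. (norm (weak_deriv g x))\<^sup>2)"
    by (intro square_integrable_integrable circle_L2_square_integrable W12_circle_L2 weak_deriv_W12 g)+
  have "ennreal ((sq_norm circle_measure g + sq_norm circle_measure (weak_deriv g)) / 2) =
      ennreal (\<integral>x. ((norm (g x))\<^sup>2 + (norm (weak_deriv g x))\<^sup>2) / 2 \<partial>circle_measure)"
    using int by (simp add: sq_norm_def)
  also have "\<dots> = (\<integral>\<^sup>+x. ennreal (((norm (g x))\<^sup>2 + (norm (weak_deriv g x))\<^sup>2) / 2) \<partial>circle_measure)"
    using int by (intro nn_integral_eq_integral[symmetric]) auto
  \<comment> \<open>\<open>h\<close> is nonnegative, so dropping the determinant term can only lower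
    the integrand.\<close>
  also have "\<dots> \<le> circle_energy h g"
    unfolding circle_energy_jet jet_energy_def jet_def by (intro nn_integral_mono) simp
  also note c(1)
  finally have "(sq_norm circle_measure g + sq_norm circle_measure (weak_deriv g)) / 2 \<le> c"
    using c(2) by simp
  then show "sq_norm circle_measure g \<le> 2 * c" "sq_norm circle_measure (weak_deriv g) \<le> 2 * c"
    using sq_norm_nonneg[of circle_measure g] sq_norm_nonneg[of circle_measure "weak_deriv g"] by auto
qed

theorem proposition3p1:
  fixes h :: "real \<Rightarrow> ennreal" and C :: "(real \<Rightarrow> real^2) set"
  assumes "det_energy h"
    and "C \<subseteq> circle_W12" and "C \<noteq> {}" and "W12_weakly_closed C"
    and "\<forall>g\<in>C. circle_energy h g < \<infinity>"
  shows "\<exists>g\<in>C. \<forall>f\<in>C. circle_energy h g \<le> circle_energy h f"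
proof -
  note h = assms(1)
  define E where "E = (INF f\<in>C. circle_energy h f)"
  define c where "c = enn2real E"
  have "E < \<infinity>"
    using assms(3,5) by (auto simp: E_def INF_less_iff)
  then have E: "E = ennreal c"
    by (simp add: c_def)
  have c0: "0 \<le> c"
    by (simp add: c_def)
  have "\<exists>f\<in>C. circle_energy h f < ennreal (c + 1 / real (Suc n))" for n
  proof -
    have "E < ennreal (c + 1 / real (Suc n))"
      unfolding E using c0 by (intro ennreal_lessI) (auto intro: add_nonneg_pos)
    then show ?thesis
      by (simp add: E_def INF_less_iff)
  qed
  then obtain X where XC: "\<And>n. X n \<in> C"
    and X_le: "\<And>n. circle_energy h (X n) \<le> ennreal (c + 1 / real (Suc n))"
    by (metis less_imp_le)
  have X: "X n \<in> circle_W12" for n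
    using XC assms(2) by blast
  \<comment> \<open>The excess over the infimum is at most 1, so a single bound serves the whole
    sequence, and coercivity turns it into \<open>2 * (c + 1)\<close>.\<close>
  have X_le1: "circle_energy h (X n) \<le> ennreal (c + 1)" for n
    by (rule order_trans[OF X_le ennreal_leI]) simp
  have B: "sq_norm circle_measure (X n) \<le> 2 * (c + 1)"
    "sq_norm circle_measure (weak_deriv (X n)) \<le> 2 * (c + 1)" for n
    using circle_energy_coercive[OF X X_le1] c0 by simp_all
  obtain k G M where k: "strict_mono (k :: nat \<Rightarrow> nat)"
    and M: "\<forall>n. AE x in circle_measure. norm (X n x) \<le> M"
    and unif: "\<forall>e>0. \<exists>N. \<forall>n\<ge>N. AE x in circle_measure. norm (X (k n) x - G x) \<le> e"
    by (rule W12_bounded_imp_uniform_subsequence[OF X B]) (rule that)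
  obtain g P where g: "g \<in> circle_W12" "AE x in circle_measure. g x = G x"
    and P: "\<forall>m. P m \<in> midpoint_hull (\<lambda>n. jet (X (k n))) m"
    and lim: "AE x in circle_measure. \<exists>r. (\<lambda>m. P m x) \<longlonglongrightarrow>
      ((g x, weak_deriv g x), (wedge (g x) (weak_deriv g x), r))"
    by (rule W12_midpoint_limit[of "\<lambda>n. X (k n)", OF X B spec[OF M]])
      (erule unif[rule_format], rule that)
  have "W12_weakly_converges (\<lambda>n. X (k n)) g"
    by (rule W12_weakly_converges_of_uniform[OF X B spec[OF M] _ g]) (erule unif[rule_format])
  then have gC: "g \<in> C"
    using assms(4)[unfolded W12_weakly_closed_def, rule_format, of "\<lambda>n. X (k n)" g] XC g(1) by simp
  \<comment> \<open>\<open>P m\<close> averages only \<open>X (k n)\<close> with \<open>n\<close> at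
    least \<open>m\<close>, and \<open>k n\<close> is at least \<open>n\<close>; each of these
    exceeds the infimum by at most \<open>1 / real (Suc m)\<close>.\<close>
  have energy: "P m \<in> borel_measurable circle_measure \<and>
      (\<integral>\<^sup>+x. jet_energy h (P m x) \<partial>circle_measure) \<le> ennreal (c + 1 / real (Suc m))" for m
  proof (rule midpoint_hull_jet_energy_le[OF h _ _ P[rule_format]])
    show "jet (X (k n)) \<in> borel_measurable circle_measure" for n
      by (rule borel_measurable_jet[OF X])
    fix n assume "m \<le> n"
    then have "m \<le> k n"
      using strict_mono_imp_increasing[OF k, of n] by simp
    then have "c + 1 / real (Suc (k n)) \<le> c + 1 / real (Suc m)"
      by (simp add: frac_le)
    then show "(\<integral>\<^sup>+x. jet_energy h (jet (X (k n)) x) \<partial>circle_measure) \<le> ennreal (c + 1 / real (Suc m))"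
      unfolding circle_energy_jet[symmetric] by (rule order_trans[OF X_le ennreal_leI])
  qed
  \<comment> \<open>Whatever \<open>r\<close> is, the density along \<open>P m x\<close> converges
    to its value at the jet of \<open>g\<close>, so the integrand is a limit inferior, as Fatou's
    lemma wants it.\<close>
  have "circle_energy h g = (\<integral>\<^sup>+x. liminf (\<lambda>m. jet_energy h (P m x)) \<partial>circle_measure)"
    unfolding circle_energy_jet
  proof (rule nn_integral_cong_AE)
    show "AE x in circle_measure. jet_energy h (jet g x) = liminf (\<lambda>m. jet_energy h (P m x))"
      using lim
    proof eventually_elim
      case (elim x)
      then obtain r where "(\<lambda>m. P m x) \<longlonglongrightarrow> ((g x, weak_deriv g x), (wedge (g x) (weak_deriv g x), r))"
        by blast
      from lim_imp_Liminf[OF _ tendsto_jet_energy[OF h this]] show ?case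
        by (simp add: jet_energy_def jet_def)
    qed
  qed
  also have "\<dots> \<le> liminf (\<lambda>m. \<integral>\<^sup>+x. jet_energy h (P m x) \<partial>circle_measure)"
    using energy by (intro nn_integral_liminf borel_measurable_jet_energy[OF h]) blast
  also have "\<dots> \<le> liminf (\<lambda>m. ennreal (c + 1 / real (Suc m)))"
    using energy by (intro Liminf_mono always_eventually) blast
  also have "\<dots> = ennreal c"
  proof (rule lim_imp_Liminf)
    have "(\<lambda>m. c + 1 / real (Suc m)) \<longlonglongrightarrow> c + 0"
      using LIMSEQ_inverse_real_of_nat by (intro tendsto_add tendsto_const) (simp add: inverse_eq_divide)
    then show "(\<lambda>m. ennreal (c + 1 / real (Suc m))) \<longlonglongrightarrow> ennreal c"
      by (intro tendsto_ennrealI) simp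
  qed simp
  finally have "circle_energy h g \<le> E"
    by (simp add: E)
  then have "circle_energy h g \<le> circle_energy h f" if "f \<in> C" for f
    using that INF_lower[of f C "circle_energy h"] order_trans unfolding E_def by blast
  then show ?thesis
    using gC by blast
qed

end
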